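(* For all integers $k\geq 1$ and $n\geq 2k+1$, the bipartite Kneser graph $H(n,k)$ has a Hamilton cycle.
   Context: For integers $k\geq 1$ and $n\geq 2k+1$, the bipartite Kneser graph $H(n,k)$ is the graph whose vertices are all $k$-element subsets and all $(n-k)$-element subsets of $[n]=\{1,2,\ldots,n\}$, with an edge between two vertices whenever one of the two sets is a subset of the other. *)

theory Defs
  imports "Graph_Theory.Graph_Theory"
begin

(* In Graph_Theory an undirected graph is a symmetric digraph, in which a single edge {a, b}
   traversed back and forth (a, b, a) satisfies cycle; the length bound excludes this.
   The vertices visited by a closed walk are the tails of its arcs. *)
definition (in pre_digraph) hamiltonian_cycle :: "'b awalk \<Rightarrow> bool" where
  "hamiltonian_cycle p \<longleftrightarrow> cycle p \<and> 3 \<le> length p \<and> tail G ` set p = verts G"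

definition bipartite_kneser_verts :: "nat \<Rightarrow> nat \<Rightarrow> nat set set" where
  "bipartite_kneser_verts n k =
     {A. A \<subseteq> {1..n} \<and> card A = k} \<union> {A. A \<subseteq> {1..n} \<and> card A = n - k}"

(* A \<noteq> B only removes loops: for n \<ge> 2 * k + 1 two comparable distinct vertices
   have different sizes, one k and the other n - k. *)
definition bipartite_kneser :: "nat \<Rightarrow> nat \<Rightarrow> nat set pair_pre_digraph" where
  "bipartite_kneser n k =
     \<lparr> pverts = bipartite_kneser_verts n k,
       parcs = {(A, B). A \<in> bipartite_kneser_verts n k \<and> B \<in> bipartite_kneser_verts n k
                  \<and> A \<noteq> B \<and> (A \<subseteq> B \<or> B \<subseteq> A)} \<rparr>"

lemma pair_graph_bipartite_kneser: "pair_graph (bipartite_kneser n k)"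
proof -
  have fin: "finite (bipartite_kneser_verts n k)"
    by (rule finite_subset[of _ "Pow {1..n}"]) (auto simp: bipartite_kneser_verts_def)
  show ?thesis
  proof unfold_locales
    show "finite (parcs (bipartite_kneser n k))"
      by (rule finite_subset[of _ "bipartite_kneser_verts n k \<times> bipartite_kneser_verts n k"])
        (auto simp: bipartite_kneser_def fin)
  qed (auto simp: bipartite_kneser_def fin symmetric_def sym_def)
qed

end

theory Submission
  imports Defs
begin

text \<open>
  The proof has two parts.

  For n = 2 k + 1 the graph is the graph of the two middle levels of the cube, and the argument is
  that of Muetze, Gregor and Nummenpalo. Cyclic parenthesis matching identifies the words of length
  2 k + 1 with k or k + 1 letters True with triples of a Dyck word u of length 2 k, a position and the
  letter left unmatched. Two natural perfect matchings then combine to a 2-factor in which the Dyck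
  word is rotated as a rooted plane tree, so that its cycles are indexed by unrooted plane trees.
  Moving a leaf one step closer to the root relates two trees by a 6-cycle that meets the cycle of
  the one tree in two edges and that of the other in one edge. Every tree is thereby attached to a
  tree of smaller minimal height sum, and each cycle is attached only once, so that the switches do
  not interfere.

  For larger n, following Muetze and Su, one constructs by induction a cycle through all k-sets
  and as many (k+1)-sets, together with disjoint saturated chains from these (k+1)-sets up to level
  n - k; replacing each (k+1)-set by the top of its chain gives a Hamilton cycle. To pass from
  n to n + 1, the cycle for (n, k) and a copy of the cycle for (n, k - 1) with n + 1 added to all its
  sets are joined after a permutation of the ground set, using a chain that the second system leaves free.
\<close>

section \<open>Hamilton paths and cycles as edge sets\<close>

text \<open>Cutting one edge in each of two cycles is not enough to join them in the passage to n +
  1. Lower sets of the second cycle contain n + 1 and upper sets of the first do not, so every edge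
  between the cycles leads from a lower set of the first to an upper set of the second; but a cut
  edge frees one set of each kind. Hence an upper set y of the first system is deleted, which frees
  its two lower neighbours, and a new upper set is inserted into the second, so that the number of
  upper sets stays right. The new set needs a chain disjoint from all others; this is why a chain
  has to be left free at all. The ground set is permuted so that the chain of y fits this free
  chain, and deleting y leaves its own chain free for the next step.

  In the middle levels the root of the tree of switches is the star, which has no leaf to pull when
  rooted at its centre. Heights are minimised over all rootings because a pull is described for a
  rooted tree, while a cycle only knows the unrooted one.\<close>

fun path_edges :: "'a list \<Rightarrow> 'a set set" where
  "path_edges (x # y # xs) = insert {x, y} (path_edges (y # xs))"
| "path_edges _ = {}"

text \<open>The edge set is exact, not an upper bound. Direction and starting point are hidden,
  switches become set operations on \<open>F\<close>, and it can be read off which edges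
  survive.\<close>

definition ham_path :: "'a set \<Rightarrow> 'a set set \<Rightarrow> 'a \<Rightarrow> 'a \<Rightarrow> bool" where
  "ham_path V F a b \<longleftrightarrow>
     (\<exists>xs. xs \<noteq> [] \<and> distinct xs \<and> set xs = V \<and> hd xs = a \<and> last xs = b \<and> path_edges xs = F)"

definition ham_cycle :: "'a set \<Rightarrow> 'a set set \<Rightarrow> bool" where
  "ham_cycle V F \<longleftrightarrow>
     (\<exists>xs. distinct xs \<and> 3 \<le> length xs \<and> set xs = V \<and> insert {last xs, hd xs} (path_edges xs) = F)"

lemma path_edges_Cons:
  "xs \<noteq> [] \<Longrightarrow> path_edges (x # xs) = insert {x, hd xs} (path_edges xs)"
  by (cases xs) auto

lemma path_edges_append:
  assumes "xs \<noteq> []" "ys \<noteq> []"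
  shows "path_edges (xs @ ys) = insert {last xs, hd ys} (path_edges xs \<union> path_edges ys)"
  using assms
proof (induction xs)
  case (Cons x xs)
  then show ?case by (cases "xs = []") (auto simp: path_edges_Cons)
qed simp

lemma path_edges_rev: "path_edges (rev xs) = path_edges xs"
proof (induction xs)
  case (Cons x xs)
  then show ?case
    by (cases "xs = []") (simp_all add: path_edges_append path_edges_Cons last_rev insert_commute[of x "hd xs"])
qed simp

lemma path_edges_map: "path_edges (map f xs) = (`) f ` path_edges xs"
proof (induction xs)
  case (Cons x xs)
  then show ?case by (cases "xs = []") (auto simp: path_edges_Cons hd_map)
qed simp

lemma path_edges_subset: "e \<in> path_edges xs \<Longrightarrow> e \<subseteq> set xs"
  by (induction xs rule: path_edges.induct) auto

lemma path_edges_split: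
  assumes "e \<in> path_edges xs"
  obtains ys zs where "xs = ys @ zs" "ys \<noteq> []" "zs \<noteq> []" "e = {last ys, hd zs}"
  using assms
proof (induction xs arbitrary: thesis rule: path_edges.induct)
  case (1 x y xs)
  show ?case
  proof (cases "e = {x, y}")
    case True
    then show ?thesis using "1.prems"(1)[of "[x]" "y # xs"] by simp
  next
    case False
    then obtain ys zs where "y # xs = ys @ zs" "ys \<noteq> []" "zs \<noteq> []" "e = {last ys, hd zs}"
      using "1.IH" "1.prems"(2) by auto
    then show ?thesis using "1.prems"(1)[of "x # ys" zs] by simp
  qed
qed auto

text \<open>With two vertices the closing edge would be the path edge, hence the bound 3. It follows
  that opening a cycle at an edge removes exactly that edge.\<close>

lemma closing_edge_notin_path_edges:
  assumes "distinct xs" "3 \<le> length xs"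
  shows "{last xs, hd xs} \<notin> path_edges xs"
proof
  assume "{last xs, hd xs} \<in> path_edges xs"
  then obtain ys zs where s: "xs = ys @ zs" "ys \<noteq> []" "zs \<noteq> []"
    and e: "{last xs, hd xs} = {last ys, hd zs}" by (rule path_edges_split)
  have ds: "set ys \<inter> set zs = {}" "distinct ys" "distinct zs" using assms(1) s(1) by auto
  have "last zs \<noteq> last ys" "hd ys \<noteq> hd zs"
    using ds(1) s(2,3) last_in_set hd_in_set by (metis disjoint_iff)+
  then have eq: "last zs = hd zs" "hd ys = last ys"
    using e s(1-3) by (auto simp: doubleton_eq_iff)
  have "tl zs = []" "tl ys = []"
    using eq ds(2,3) s(2,3) by (cases zs; cases ys; force split: if_splits)+
  then have "length zs \<le> 1" "length ys \<le> 1"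
    by (cases zs; cases ys; simp)+
  then show False using assms(2) s(1) by simp
qed

lemma ham_path_edge_subset: "ham_path V F a b \<Longrightarrow> e \<in> F \<Longrightarrow> e \<subseteq> V"
  unfolding ham_path_def using path_edges_subset by metis

lemma ham_path_singleton: "ham_path {a} {} a a"
  unfolding ham_path_def by (rule exI[of _ "[a]"]) simp

lemma ham_path_sym: "ham_path V F a b \<Longrightarrow> ham_path V F b a"
  unfolding ham_path_def by (elim exE, rule_tac x = "rev xs" in exI) (auto simp: path_edges_rev hd_rev last_rev)

lemma ham_path_join:
  assumes "ham_path V F a b" "ham_path W G c d" "V \<inter> W = {}"
  shows "ham_path (V \<union> W) (insert {b, c} (F \<union> G)) a d"
proof -
  obtain xs ys where "xs \<noteq> []" "distinct xs" "set xs = V" "hd xs = a" "last xs = b" "path_edges xs = F"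
    "ys \<noteq> []" "distinct ys" "set ys = W" "hd ys = c" "last ys = d" "path_edges ys = G"
    using assms(1,2) unfolding ham_path_def by blast
  then show ?thesis using assms(3)
    unfolding ham_path_def by (intro exI[of _ "xs @ ys"]) (auto simp: path_edges_append)
qed

lemma ham_path_close:
  assumes "ham_path V F a b" "3 \<le> card V"
  shows "ham_cycle V (insert {b, a} F)"
proof -
  obtain xs where "distinct xs" "set xs = V" "hd xs = a" "last xs = b" "path_edges xs = F"
    using assms(1) unfolding ham_path_def by blast
  then show ?thesis using assms(2) unfolding ham_cycle_def
    by (intro exI[of _ xs]) (auto simp: distinct_card)
qed

text \<open>Cutting a cyclic list at another edge swaps the two parts of the list; reversal then
  puts the ends in the prescribed order.\<close>

lemma ham_cycle_open_ends:
  assumes "distinct xs" "3 \<le> length xs" "{a, b} \<in> insert {last xs, hd xs} (path_edges xs)"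
  obtains ys where "distinct ys" "length ys = length xs" "set ys = set xs" "hd ys = a" "last ys = b"
    "insert {last ys, hd ys} (path_edges ys) = insert {last xs, hd xs} (path_edges xs)"
proof -
  have "\<exists>ys. distinct ys \<and> length ys = length xs \<and> set ys = set xs \<and> {hd ys, last ys} = {a, b} \<and>
    insert {last ys, hd ys} (path_edges ys) = insert {last xs, hd xs} (path_edges xs)"
  proof (cases "{a, b} = {last xs, hd xs}")
    case True
    then show ?thesis using assms by (intro exI[of _ xs]) auto
  next
    case False
    then obtain us vs where s: "xs = us @ vs" "us \<noteq> []" "vs \<noteq> []" "{a, b} = {last us, hd vs}"
      using assms(3) path_edges_split by (metis insertE)
    have "insert {last us, hd vs} (path_edges (vs @ us)) = insert {last vs, hd us} (path_edges (us @ vs))"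
      using s(2,3) by (auto simp: path_edges_append)
    then show ?thesis using s assms(1) by (intro exI[of _ "vs @ us"]) auto
  qed
  then obtain ys where ys: "distinct ys" "length ys = length xs" "set ys = set xs" "{hd ys, last ys} = {a, b}"
    "insert {last ys, hd ys} (path_edges ys) = insert {last xs, hd xs} (path_edges xs)" by blast
  show thesis
  proof (cases "hd ys = a \<and> last ys = b")
    case True
    then show ?thesis using that ys by blast
  next
    case False
    then have "hd (rev ys) = a" "last (rev ys) = b"
      using ys(4) by (auto simp: doubleton_eq_iff hd_rev last_rev)
    moreover have "insert {last (rev ys), hd (rev ys)} (path_edges (rev ys)) = insert {last ys, hd ys} (path_edges ys)"
      by (auto simp: path_edges_rev hd_rev last_rev insert_commute)
    ultimately show ?thesis using that[of "rev ys"] ys by simp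
  qed
qed

lemma ham_cycle_open:
  assumes "ham_cycle V F" "{a, b} \<in> F"
  shows "ham_path V (F - {{a, b}}) a b"
proof -
  obtain xs where xs: "distinct xs" "3 \<le> length xs" "set xs = V"
    "insert {last xs, hd xs} (path_edges xs) = F"
    using assms(1) unfolding ham_cycle_def by blast
  obtain ys where ys: "distinct ys" "length ys = length xs" "set ys = set xs" "hd ys = a" "last ys = b"
    "insert {last ys, hd ys} (path_edges ys) = F"
    using ham_cycle_open_ends[OF xs(1,2)] assms(2) xs(4) by metis
  have "{last ys, hd ys} \<notin> path_edges ys"
    using closing_edge_notin_path_edges ys xs by metis
  then have "path_edges ys = F - {{a, b}}" using ys(4-6) by (auto simp: insert_commute)
  moreover have "ys \<noteq> []" using ys(2) xs(2) by auto
  ultimately show ?thesis unfolding ham_path_def using ys(1,3-5) xs(3) by (intro exI[of _ ys]) simp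
qed

lemma ham_path_drop_hd:
  assumes "ham_path V F a b" "{a, c} \<in> F"
  shows "ham_path (V - {a}) (F - {{a, c}}) c b"
proof -
  obtain xs where xs: "xs \<noteq> []" "distinct xs" "set xs = V" "hd xs = a" "last xs = b" "path_edges xs = F"
    using assms(1) unfolding ham_path_def by blast
  then obtain ys where ys: "xs = a # ys" by (metis list.exhaust_sel)
  then have ne: "ys \<noteq> []" using xs assms(2) by auto
  have an: "a \<notin> set ys" using xs ys by simp
  have "{a, c} \<notin> path_edges ys" using path_edges_subset[of "{a, c}" ys] an by auto
  moreover have "{a, c} \<in> insert {a, hd ys} (path_edges ys)" using xs ys ne assms(2) by (auto simp: path_edges_Cons)
  ultimately have "hd ys = c" "F - {{a, c}} = path_edges ys" using xs ys ne by (auto simp: path_edges_Cons doubleton_eq_iff)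
  then show ?thesis unfolding ham_path_def using xs ys ne an by (intro exI[of _ ys]) auto
qed

lemma ham_cycle_drop:
  assumes "ham_cycle V F" "{x, y} \<in> F" "{y, z} \<in> F" "x \<noteq> z"
  shows "ham_path (V - {y}) (F - {{x, y}, {y, z}}) z x"
proof -
  have "ham_path V (F - {{y, x}}) y x"
    using ham_cycle_open[OF assms(1), of y x] assms(2) by (simp add: insert_commute)
  then have "ham_path (V - {y}) (F - {{y, x}} - {{y, z}}) z x"
    by (rule ham_path_drop_hd) (use assms in \<open>auto simp: doubleton_eq_iff\<close>)
  moreover have "F - {{y, x}} - {{y, z}} = F - {{x, y}, {y, z}}" by (auto simp: insert_commute)
  ultimately show ?thesis by simp
qed

lemma ham_path_image:
  assumes "ham_path V F a b" "inj_on f V"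
  shows "ham_path (f ` V) ((`) f ` F) (f a) (f b)"
proof -
  obtain xs where xs: "xs \<noteq> []" "distinct xs" "set xs = V" "hd xs = a" "last xs = b" "path_edges xs = F"
    using assms(1) unfolding ham_path_def by blast
  then show ?thesis unfolding ham_path_def using assms(2)
    by (intro exI[of _ "map f xs"]) (auto simp: path_edges_map hd_map last_map distinct_map)
qed

lemma ham_cycle_image:
  assumes "ham_cycle V F" "inj_on f V"
  shows "ham_cycle (f ` V) ((`) f ` F)"
proof -
  obtain xs where xs: "distinct xs" "3 \<le> length xs" "set xs = V" 
    "insert {last xs, hd xs} (path_edges xs) = F"
    using assms(1) unfolding ham_cycle_def by blast
  have "xs \<noteq> []" using xs(2) by auto
  then show ?thesis unfolding ham_cycle_def using assms(2) xs
    by (intro exI[of _ "map f xs"]) (auto simp: path_edges_map hd_map last_map distinct_map)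
qed

lemma ham_cycle_edge_subset: "ham_cycle V F \<Longrightarrow> e \<in> F \<Longrightarrow> e \<subseteq> V"
proof -
  assume "ham_cycle V F" "e \<in> F"
  then obtain xs where "3 \<le> length xs" "set xs = V" "e = {last xs, hd xs} \<or> e \<in> path_edges xs"
    unfolding ham_cycle_def by blast
  then show "e \<subseteq> V" using path_edges_subset[of e xs] by (cases "xs = []") auto
qed

lemma ham_cycle_card: "ham_cycle V F \<Longrightarrow> finite V \<and> 3 \<le> card V"
  unfolding ham_cycle_def by (auto simp: distinct_card)

lemma ham_cycle_neighbour:
  assumes "ham_cycle V F" "{x, y} \<in> F"
  obtains z where "z \<noteq> x" "{y, z} \<in> F"
proof -
  obtain xs where xs: "xs \<noteq> []" "distinct xs" "set xs = V" "hd xs = y" "last xs = x" "path_edges xs = F - {{y, x}}"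
    using ham_cycle_open[OF assms(1), of y x] assms(2) unfolding ham_path_def
    by (auto simp: insert_commute)
  have "3 \<le> length xs" using xs assms(1) unfolding ham_cycle_def by (metis distinct_card)
  then obtain z w ws where ys: "xs = y # z # w # ws" using xs(4)
    by (auto simp: Suc_le_length_iff numeral_3_eq_3)
  then have "{y, z} \<in> path_edges xs" "z \<noteq> x" using xs by auto
  then show thesis using that xs by auto
qed

text \<open>
  Cycles are attached to the root cycle along a tree: the edge \<^term>\<open>{a i, b i}\<close> of the parent is replaced
  by a detour through a Hamilton path of the i-th piece. D i collects the edges of that path, so the edges
  needed later by the children of i must be among them.
\<close>
lemma ham_cycle_glue_tree:
  fixes rank :: "'i \<Rightarrow> nat"
  assumes fin: "finite I" and r: "r \<in> I"
    and par: "\<And>i. i \<in> I \<Longrightarrow> i \<noteq> r \<Longrightarrow> par i \<in> I \<and> rank (par i) < rank i"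
    and disj: "\<And>i j. i \<in> I \<Longrightarrow> j \<in> I \<Longrightarrow> i \<noteq> j \<Longrightarrow> V i \<inter> V j = {}"
    and root: "ham_cycle (V r) (D r)"
    and path: "\<And>i. i \<in> I \<Longrightarrow> i \<noteq> r \<Longrightarrow> ham_path (V i) (D i) (c i) (d i)"
    and old: "\<And>i. i \<in> I \<Longrightarrow> i \<noteq> r \<Longrightarrow> {a i, b i} \<in> D (par i)"
    and inj: "\<And>i j. i \<in> I \<Longrightarrow> j \<in> I \<Longrightarrow> i \<noteq> r \<Longrightarrow> j \<noteq> r \<Longrightarrow> {a i, b i} = {a j, b j} \<Longrightarrow> i = j"
    and D: "\<And>i. i \<in> I \<Longrightarrow> D i \<subseteq> E"
    and new: "\<And>i. i \<in> I \<Longrightarrow> i \<noteq> r \<Longrightarrow> {a i, c i} \<in> E \<and> {b i, d i} \<in> E"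
  shows "\<exists>F \<subseteq> E. ham_cycle (\<Union>i\<in>I. V i) F"
proof -
  \<comment> \<open>\<open>J\<close> ranges over the subtrees containing the root. The last conjunct
    is the invariant: the edges to be replaced by children not yet attached are still
    present.\<close>
  have "\<exists>F \<subseteq> E. ham_cycle (\<Union>i\<in>J. V i) F \<and> (\<forall>j\<in>I - J. par j \<in> J \<longrightarrow> {a j, b j} \<in> F)"
    if "J \<subseteq> I" "r \<in> J" "\<And>i. i \<in> J \<Longrightarrow> i \<noteq> r \<Longrightarrow> par i \<in> J" for J
    using that
  proof (induction "card J" arbitrary: J rule: less_induct)
    case less
    have finJ: "finite J" using less.prems(1) fin finite_subset by blast
    show ?case
    proof (cases "J = {r}")
      case True
      then show ?thesis using root D[OF r] old r by (intro exI[of _ "D r"]) auto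
    next
      case False
      then have "J - {r} \<noteq> {}" using less.prems(2) by blast
      \<comment> \<open>Ranks decrease towards the root, so an element of maximal rank is a leaf of
        the subtree, and removing it leaves a subtree.\<close>
      then have "Max (rank ` (J - {r})) \<in> rank ` (J - {r})" using finJ by simp
      then obtain i where i: "i \<in> J - {r}" "rank i = Max (rank ` (J - {r}))"
        by (metis imageE)
      have imax: "rank j \<le> rank i" if "j \<in> J - {r}" for j
        unfolding i(2) using that finJ by (intro Max_ge) auto
      have iI: "i \<in> I" "i \<noteq> r" using i less.prems(1) by auto
      let ?J = "J - {i}"
      have "card ?J < card J" using i(1) finJ by (intro card_Diff1_less) auto
      moreover have "par j \<in> ?J" if "j \<in> ?J" "j \<noteq> r" for j
      proof -
        have "rank (par j) < rank j" "rank j \<le> rank i"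
          using par[of j] imax[of j] that less.prems(1) by auto
        then show ?thesis using less.prems(3)[of j] that by auto
      qed
      ultimately obtain F where F: "F \<subseteq> E" "ham_cycle (\<Union>i\<in>?J. V i) F"
        "\<And>j. j \<in> I - ?J \<Longrightarrow> par j \<in> ?J \<Longrightarrow> {a j, b j} \<in> F"
        using less.hyps[of ?J] less.prems iI by blast
      have pari: "par i \<in> ?J" using less.prems(3)[of i] par[OF iI] i by auto
      let ?U = "\<Union>i\<in>?J. V i"
      have "ham_path ?U (F - {{a i, b i}}) (a i) (b i)"
        by (rule ham_cycle_open[OF F(2)]) (use F(3) iI pari in auto)
      moreover have "?U \<inter> V i = {}" using disj iI less.prems(1) by blast
      ultimately have P: "ham_path (?U \<union> V i) (insert {b i, d i} (F - {{a i, b i}} \<union> D i)) (a i) (c i)"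
        using ham_path_join ham_path_sym[OF path[OF iI]] by metis
      have "3 \<le> card (?U \<union> V i)"
      proof -
        have "finite (?U \<union> V i)" using P unfolding ham_path_def by (metis finite_set)
        then show ?thesis using ham_cycle_card[OF F(2)] card_mono[of "?U \<union> V i" ?U] by simp
      qed
      from ham_path_close[OF P this]
      have C: "ham_cycle (?U \<union> V i) (insert {c i, a i} (insert {b i, d i} (F - {{a i, b i}} \<union> D i)))"
        (is "ham_cycle _ ?F") .
      have "?U \<union> V i = (\<Union>i\<in>J. V i)" using i by auto
      moreover have "?F \<subseteq> E" using F(1) D[OF iI(1)] new[OF iI] by (auto simp: insert_commute)
      \<comment> \<open>Children of \<open>i\<close> find their edge in \<open>D i\<close>; every
        other pending edge differs, by \<open>inj\<close>, from the one that \<open>i\<close> has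
        just replaced.\<close>
      moreover have "{a j, b j} \<in> ?F" if "j \<in> I - J" "par j \<in> J" for j
      proof (cases "par j = i")
        case True
        then show ?thesis using old[of j] that less.prems(2) by auto
      next
        case False
        then have "{a j, b j} \<in> F" using F(3)[of j] that by auto
        moreover have "{a j, b j} \<noteq> {a i, b i}" using inj[of i j] iI that i less.prems(2) by auto
        ultimately show ?thesis by simp
      qed
      ultimately show ?thesis using C by (intro exI[of _ ?F]) auto
    qed
  qed
  from this[of I] show ?thesis using r par by blast
qed

definition alt_edges :: "(nat \<Rightarrow> 'a) \<Rightarrow> (nat \<Rightarrow> 'a) \<Rightarrow> nat \<Rightarrow> nat \<Rightarrow> 'a set set" where
  "alt_edges X Y i j = (\<lambda>l. {Y l, X l}) ` {i..j} \<union> (\<lambda>l. {X l, Y (Suc l)}) ` {i..<j}"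

lemma ham_path_alternating:
  assumes "i \<le> j" "inj_on X {i..j}" "inj_on Y {i..j}" "X ` {i..j} \<inter> Y ` {i..j} = {}"
  shows "ham_path (X ` {i..j} \<union> Y ` {i..j}) (alt_edges X Y i j) (Y i) (X j)"
  using assms
proof (induction j rule: dec_induct)
  case base
  then have "ham_path {Y i, X i} {{Y i, X i}} (Y i) (X i)"
    unfolding ham_path_def by (intro exI[of _ "[Y i, X i]"]) auto
  then show ?case unfolding alt_edges_def by (simp add: insert_commute)
next
  case (step j)
  let ?n = "Suc j"
  let ?V = "X ` {i..j} \<union> Y ` {i..j}"
  have split: "{i..?n} = insert ?n {i..j}" "{i..<?n} = insert j {i..<j}" "?n \<notin> {i..j}"
    using step.hyps by auto
  have P1: "ham_path ?V (alt_edges X Y i j) (Y i) (X j)"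
    using step.prems unfolding split by (intro step.IH) auto
  have P2: "ham_path {Y ?n, X ?n} {{Y ?n, X ?n}} (Y ?n) (X ?n)"
    using step.prems unfolding split ham_path_def by (intro exI[of _ "[Y ?n, X ?n]"]) auto
  have "?V \<inter> {Y ?n, X ?n} = {}" using step.prems split(3) unfolding split by auto
  from ham_path_join[OF P1 P2 this]
  have "ham_path (?V \<union> {Y ?n, X ?n}) (insert {X j, Y ?n} (alt_edges X Y i j \<union> {{Y ?n, X ?n}})) (Y i) (X ?n)" .
  moreover have "?V \<union> {Y ?n, X ?n} = X ` {i..?n} \<union> Y ` {i..?n}" unfolding split by auto
  moreover have "insert {X j, Y ?n} (alt_edges X Y i j \<union> {{Y ?n, X ?n}}) = alt_edges X Y i ?n"
    unfolding alt_edges_def split by auto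
  ultimately show ?case by simp
qed

section \<open>Dyck words and rotation of plane trees\<close>

inductive dyck :: "bool list \<Rightarrow> bool" where
  dyck_Nil: "dyck []"
| dyck_node: "dyck v \<Longrightarrow> dyck w \<Longrightarrow> dyck (True # v @ False # w)"

lemma dyck_append: "dyck u \<Longrightarrow> dyck w \<Longrightarrow> dyck (u @ w)"
proof (induction rule: dyck.induct)
  case (dyck_node v w')
  then show ?case using dyck.dyck_node[of v "w' @ w"] by simp
qed simp

lemma dyck_TF: "dyck [True, False]"
  using dyck_node[OF dyck_Nil dyck_Nil] by simp

lemma dyck_wrap: "dyck v \<Longrightarrow> dyck (True # v @ [False])"
  using dyck_node[OF _ dyck_Nil] by simp

text \<open>The grammar is unambiguous. This makes \<open>rot\<close> well defined, and later
  recovers \<open>v\<close> and \<open>w\<close> from \<open>v @ False # w\<close> when two pulled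
  trees are compared.\<close>

lemma dyck_first_return_unique:
  assumes "dyck v" "dyck v'" "v @ False # w = v' @ False # w'"
  shows "v = v' \<and> w = w'"
  using assms
proof (induction arbitrary: v' w w' rule: dyck.induct)
  case dyck_Nil
  then show ?case by (auto elim: dyck.cases)
next
  case (dyck_node a b)
  from dyck_node.prems(1) show ?case
  proof cases
    case dyck_Nil
    then show ?thesis using dyck_node.prems by simp
  next
    case (dyck_node a' b')
    then show ?thesis
      using dyck_node.prems dyck_node.IH(1)[of a' "b @ False # w" "b' @ False # w'"]
        dyck_node.IH(2)[of b' w w'] by simp
  qed
qed

lemma dyck_count: "dyck u \<Longrightarrow> count_list u True = count_list u False"
  by (induction rule: dyck.induct) auto

lemma count_list_bool: "count_list u True + count_list u False = length u"
  by (induction u) auto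

lemma dyck_length: "dyck u \<Longrightarrow> length u = 2 * count_list u True"
  using dyck_count[of u] count_list_bool[of u] by simp

lemma dyck_prefix:
  assumes "dyck u" "u = xs @ ys"
  shows "count_list xs False \<le> count_list xs True"
  using assms
proof (induction arbitrary: xs ys rule: dyck.induct)
  case (dyck_node v w)
  show ?case
  proof (cases xs)
    case (Cons x zs)
    then have "x = True" "v @ False # w = zs @ ys" using dyck_node.prems by auto
    then consider us where "v = zs @ us" | us where "zs = v @ False # us" "w = us @ ys"
      unfolding append_eq_append_conv2 by (auto simp: Cons_eq_append_conv)
    then show ?thesis
    proof cases
      case 1
      then show ?thesis using dyck_node.IH(1) Cons \<open>x = True\<close> by (simp add: le_SucI)
    next
      case 2
      then show ?thesis
        using dyck_node.IH(2)[of us ys] dyck_count[OF dyck_node.hyps(1)] Cons \<open>x = True\<close> by simp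
    qed
  qed simp
qed simp

lemma dyck_suffix:
  assumes "dyck (xs @ ys)"
  shows "count_list ys True \<le> count_list ys False"
  using dyck_prefix[OF assms refl] dyck_count[OF assms] by simp

text \<open>A leaf can be grafted at any position of the code; the cycle lemma needs this because a
  circle of letters may be cut anywhere.\<close>

lemma dyck_insert_TF:
  "dyck u \<Longrightarrow> i \<le> length u \<Longrightarrow> dyck (take i u @ True # False # drop i u)"
proof (induction arbitrary: i rule: dyck.induct)
  case dyck_Nil
  then show ?case using dyck_TF by simp
next
  case (dyck_node v w)
  consider "i = 0" | j where "i = Suc j" "j \<le> length v" | j where "i = Suc (length v + Suc j)" "j \<le> length w"
  proof (cases i)
    case (Suc k)
    show ?thesis
    proof (cases "k \<le> length v")
      case False
      then have "i = Suc (length v + Suc (k - length v - 1))" "k - length v - 1 \<le> length w"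
        using Suc dyck_node.prems by auto
      then show ?thesis using that(3) by blast
    qed (use Suc that in auto)
  qed (use that in auto)
  then show ?case
  proof cases
    case 1
    then show ?thesis
      using dyck.dyck_node[OF dyck_Nil dyck.dyck_node[OF dyck_node.hyps]] by simp
  next
    case 2
    then show ?thesis
      using dyck.dyck_node[OF dyck_node.IH(1)[OF 2(2)] dyck_node.hyps(2)] by simp
  next
    case 3
    then show ?thesis
      using dyck.dyck_node[OF dyck_node.hyps(1) dyck_node.IH(2)[OF 3(2)]] by simp
  qed
qed

text \<open>
  Dyck words encode rooted plane trees, and \<open>rot\<close> moves the root to its first child;
  the orbits of \<open>rot\<close> are the unrooted plane trees.
\<close>
definition rot :: "bool list \<Rightarrow> bool list" where
  "rot u = (THE u'. \<exists>v w. dyck v \<and> dyck w \<and> u = True # v @ False # w \<and> u' = v @ True # w @ [False])"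

lemma rot_node: "dyck v \<Longrightarrow> dyck w \<Longrightarrow> rot (True # v @ False # w) = v @ True # w @ [False]"
  unfolding rot_def by (rule the_equality) (auto dest: dyck_first_return_unique)

lemma dyck_rot: "dyck u \<Longrightarrow> u \<noteq> [] \<Longrightarrow> dyck (rot u) \<and> length (rot u) = length u"
  by (erule dyck.cases) (auto simp: rot_node intro: dyck_append dyck_wrap)

lemma dyck_rot_pow: "dyck u \<Longrightarrow> u \<noteq> [] \<Longrightarrow> dyck ((rot ^^ j) u) \<and> length ((rot ^^ j) u) = length u"
proof (induction j)
  case (Suc j)
  then have "(rot ^^ j) u \<noteq> []" by (metis length_0_conv)
  then show ?case using Suc dyck_rot[of "(rot ^^ j) u"] by simp
qed simp

text \<open>Each application of \<open>rot\<close> moves the root one step along the contour of the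
  tree. Walking around the part coded by \<open>v\<close> takes one step per letter (down an edge,
  around the subtree, back up, around the remaining children), after which this part comes
  last.\<close>

lemma rot_pow_append:
  "dyck v \<Longrightarrow> dyck s \<Longrightarrow> (rot ^^ length v) (v @ s) = s @ v"
proof (induction arbitrary: s rule: dyck.induct)
  case (dyck_node a b)
  have "length (True # a @ False # b) = length b + Suc (length a + Suc 0)" by simp
  then have "(rot ^^ length (True # a @ False # b)) ((True # a @ False # b) @ s)
      = (rot ^^ length b) (rot ((rot ^^ length a) (rot (True # a @ False # (b @ s)))))"
    by (simp only: funpow_add comp_apply funpow.simps id_apply append.simps append_assoc)
  also have "rot (True # a @ False # (b @ s)) = a @ (True # (b @ s) @ [False])"
    using dyck_node by (intro rot_node dyck_append)
  also have "(rot ^^ length a) \<dots> = (True # (b @ s) @ [False]) @ a"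
    using dyck_node by (intro dyck_node.IH dyck_wrap dyck_append)
  also have "\<dots> = True # (b @ s) @ False # a" by simp
  also have "rot \<dots> = (b @ s) @ True # a @ [False]"
    using dyck_node by (intro rot_node dyck_append)
  also have "\<dots> = b @ (s @ (True # a @ [False]))" by simp
  also have "(rot ^^ length b) \<dots> = (s @ (True # a @ [False])) @ b"
    using dyck_node by (intro dyck_node.IH dyck_wrap dyck_append)
  finally show ?case by simp
qed simp

lemma rot_pow_length: "dyck u \<Longrightarrow> (rot ^^ length u) u = u"
  using rot_pow_append[OF _ dyck_Nil] by simp

lemma rot_pow_mult_length:
  assumes "dyck u"
  shows "(rot ^^ (j * length u)) u = u"
proof (induction j)
  case (Suc j)
  then show ?case using rot_pow_length[OF assms] by (simp only: mult_Suc funpow_add comp_apply)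
qed simp

text \<open>A leaf that is the first child of a non-root vertex c is reattached to the parent of c, just before c.\<close>
inductive pull :: "bool list \<Rightarrow> bool list \<Rightarrow> bool" where
  pull_here: "dyck v \<Longrightarrow> dyck w \<Longrightarrow> pull (True # True # False # v @ False # w) (True # False # True # v @ False # w)"
| pull_left: "pull v v' \<Longrightarrow> dyck w \<Longrightarrow> pull (True # v @ False # w) (True # v' @ False # w)"
| pull_right: "pull w w' \<Longrightarrow> dyck v \<Longrightarrow> pull (True # v @ False # w) (True # v @ False # w')"

lemma pull_dyck: "pull u u' \<Longrightarrow> dyck u \<and> dyck u'"
proof (induction rule: pull.induct)
  case (pull_here v w)
  have "dyck (True # (True # [] @ False # v) @ False # w)" "dyck (True # [] @ False # True # v @ False # w)"
    using pull_here by (intro dyck_node dyck_Nil; simp)+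
  then show ?case by simp
qed (auto intro: dyck_node)

lemma pull_swap: "pull u u' \<Longrightarrow> \<exists>xs ys. u = xs @ True # False # ys \<and> u' = xs @ False # True # ys"
proof (induction rule: pull.induct)
  case (pull_here v w)
  show ?case by (rule_tac x = "[True]" in exI) simp
next
  case (pull_left v v' w)
  then obtain xs ys where "v = xs @ True # False # ys" "v' = xs @ False # True # ys" by blast
  then show ?case by (intro exI[of _ "True # xs"] exI[of _ "ys @ False # w"]) simp
next
  case (pull_right w w' v)
  then obtain xs ys where "w = xs @ True # False # ys" "w' = xs @ False # True # ys" by blast
  then show ?case by (intro exI[of _ "True # v @ False # xs"] exI[of _ "ys"]) simp
qed

text \<open>The contours of both trees agree up to the place of the change, so the same number of
  steps re-roots both of them there. The word \<open>s\<close> collects the part of the tree that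
  follows; it grows when the induction enters a subtree.\<close>

lemma pull_rot:
  assumes "pull u u'" "dyck s"
  shows "\<exists>j v w. dyck v \<and> dyck w \<and> (rot ^^ j) (u @ s) = True # True # False # v @ False # w \<and>
           (rot ^^ j) (u' @ s) = True # False # True # v @ False # w"
  using assms
proof (induction arbitrary: s rule: pull.induct)
  case (pull_here v w)
  then show ?case by (rule_tac x = 0 in exI, rule_tac x = v in exI, rule_tac x = "w @ s" in exI) (simp add: dyck_append)
next
  case (pull_left v v' w)
  have ws: "dyck (w @ s)" using pull_left by (simp add: dyck_append)
  have r: "rot ((True # a @ False # w) @ s) = a @ (True # (w @ s) @ [False])" if "dyck a" for a
    using rot_node[OF that ws] by simp
  obtain j a b where j: "dyck a" "dyck b" "(rot ^^ j) (v @ (True # (w @ s) @ [False])) = True # True # False # a @ False # b"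
    "(rot ^^ j) (v' @ (True # (w @ s) @ [False])) = True # False # True # a @ False # b"
    using pull_left.IH[OF dyck_wrap[OF ws]] by blast
  have "dyck v" "dyck v'" using pull_dyck[OF pull_left.hyps(1)] by auto
  then show ?case using j r
    by (rule_tac x = "Suc j" in exI, rule_tac x = a in exI, rule_tac x = b in exI)
      (simp only: funpow_Suc_right comp_apply)
next
  case (pull_right w w' v)
  let ?t = "True # v @ [False]"
  have r: "(rot ^^ length ?t) ((True # v @ False # a) @ s) = a @ (s @ ?t)" if "dyck a" for a
    using rot_pow_append[of ?t "a @ s"] pull_right that by (simp add: dyck_append dyck_wrap)
  obtain j a b where j: "dyck a" "dyck b" "(rot ^^ j) (w @ (s @ ?t)) = True # True # False # a @ False # b"
    "(rot ^^ j) (w' @ (s @ ?t)) = True # False # True # a @ False # b"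
    using pull_right.IH[OF dyck_append[OF pull_right.prems dyck_wrap[OF pull_right.hyps(2)]]] by blast
  have "dyck w" "dyck w'" using pull_dyck[OF pull_right.hyps(1)] by auto
  then show ?case using j r
    by (rule_tac x = "j + length ?t" in exI, rule_tac x = a in exI, rule_tac x = b in exI)
      (simp only: funpow_add comp_apply)
qed

text \<open>If the first child of the root is not a leaf, then a pull is possible inside its subtree
  or that subtree is a star, whose first leaf can be pulled up.\<close>

lemma pull_or_star:
  "dyck u \<Longrightarrow> (\<exists>u'. pull u u') \<or> (\<exists>n. u = concat (replicate n [True, False]))"
proof (induction rule: dyck.induct)
  case dyck_Nil
  then show ?case by (intro disjI2 exI[of _ 0]) simp
next
  case (dyck_node v w)
  show ?case
  proof (cases "v = []")
    case True
    from dyck_node.IH(2) show ?thesis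
    proof
      assume "\<exists>n. w = concat (replicate n [True, False])"
      then obtain n where "w = concat (replicate n [True, False])" ..
      then show ?thesis using True by (intro disjI2 exI[of _ "Suc n"]) simp
    qed (use dyck_node.hyps pull_right in blast)
  next
    case False
    from dyck_node.IH(1) show ?thesis
    proof
      assume "\<exists>n. v = concat (replicate n [True, False])"
      then obtain n where "v = concat (replicate n [True, False])" ..
      then obtain n' where n: "v = True # False # concat (replicate n' [True, False])"
        using False by (cases n) auto
      have "dyck (concat (replicate i [True, False]))" for i
        by (induction i) (auto intro: dyck_Nil dyck_append[OF dyck_TF, simplified])
      then show ?thesis using pull_here[of _ w] dyck_node.hyps n by auto
    qed (use dyck_node.hyps pull_left in blast)
  qed
qed

text \<open>On Dyck words with m letters \<open>True\<close> this is the sum of the depths of the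
  vertices plus the constant m^2 - m, computed without matching letters.\<close>

fun weight :: "bool list \<Rightarrow> nat" where
  "weight [] = 0"
| "weight (x # xs) = (if x then length xs else 0) + weight xs"

lemma weight_swap: "weight (xs @ False # True # ys) < weight (xs @ True # False # ys)"
  by (induction xs) auto

lemma pull_weight: "pull u u' \<Longrightarrow> weight u' < weight u"
  using pull_swap weight_swap by fastforce

lemma pull_length: "pull u u' \<Longrightarrow> length u' = length u"
  using pull_swap by fastforce

definition orbit_rot :: "bool list \<Rightarrow> bool list set" where
  "orbit_rot u = {(rot ^^ j) u | j. True}"

lemma orbit_rot_self: "u \<in> orbit_rot u"
  unfolding orbit_rot_def by (auto intro: exI[of _ 0])

text \<open>Orbits consist of forward iterates only; the way back comes from the period
  \<open>length u\<close>.\<close>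

lemma orbit_rot_eq:
  assumes "dyck u" "u \<noteq> []" "v \<in> orbit_rot u"
  shows "orbit_rot v = orbit_rot u"
proof -
  obtain j where j: "v = (rot ^^ j) u" using assms(3) unfolding orbit_rot_def by blast
  note cyc = rot_pow_mult_length[OF assms(1), of j]
  have "j * length u = (j * length u - j) + j" using assms(2) by (cases "length u") auto
  then have u: "u = (rot ^^ (j * length u - j)) v" using cyc j by (metis comp_apply funpow_add)
  show ?thesis
  proof
    show "orbit_rot v \<subseteq> orbit_rot u"
    proof
      fix z assume "z \<in> orbit_rot v"
      then obtain i where "z = (rot ^^ i) v" unfolding orbit_rot_def by blast
      then have "z = (rot ^^ (i + j)) u" using j by (metis comp_apply funpow_add)
      then show "z \<in> orbit_rot u" unfolding orbit_rot_def by blast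
    qed
    show "orbit_rot u \<subseteq> orbit_rot v"
    proof
      fix z assume "z \<in> orbit_rot u"
      then obtain i where "z = (rot ^^ i) u" unfolding orbit_rot_def by blast
      then have "z = (rot ^^ (i + (j * length u - j))) v" using u by (metis comp_apply funpow_add)
      then show "z \<in> orbit_rot v" unfolding orbit_rot_def by blast
    qed
  qed
qed

section \<open>The middle levels\<close>

lemma count_list_rotate: "count_list (rotate p xs) x = count_list xs x"
proof (induction p)
  case (Suc p)
  have "count_list (rotate1 ys) x = count_list ys x" for ys by (cases ys) auto
  then show ?case using Suc by simp
qed simp

lemma rotate_inject: "rotate p xs = rotate p ys \<longleftrightarrow> xs = ys"
  unfolding rotate_def using inj_rotate1 by (metis inj_eq inj_fn)

lemma rotate_Cons_snoc: "length xs = n \<Longrightarrow> rotate n (xs @ [x]) = x # xs"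
  using rotate_append[of xs "[x]"] by simp

text \<open>If the circle had two such cuts, a segment between the two unmatched letters would be a
  prefix of one Dyck word and a suffix of the other. It is then balanced, and the letter
  \<open>b\<close> next to it violates the prefix or suffix inequality.\<close>

lemma dyck_snoc_rotate_eq:
  assumes "dyck u" "dyck u'" "length u' = length u" "r \<le> length u" "u @ [b] = rotate r (u' @ [b])"
  shows "r = 0"
proof (rule ccontr)
  assume "r \<noteq> 0"
  define \<alpha> \<beta> where "\<alpha> = take r u'" and "\<beta> = drop r u'"
  have u': "u' = \<alpha> @ \<beta>" and len: "length \<alpha> = r" using assms(3,4) by (simp_all add: \<alpha>_def \<beta>_def)
  have "u @ [b] = \<beta> @ [b] @ \<alpha>" using assms(5) rotate_append[of \<alpha> "\<beta> @ [b]"] u' len by simp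
  moreover have "\<alpha> \<noteq> []" using len \<open>r \<noteq> 0\<close> by auto
  ultimately obtain \<alpha>' where \<alpha>': "\<alpha> = \<alpha>' @ [b]" "u = \<beta> @ b # \<alpha>'"
    by (cases \<alpha> rule: rev_cases) auto
  show False
  proof (cases b)
    case True
    have "count_list (b # \<alpha>') True \<le> count_list (b # \<alpha>') False"
      using dyck_suffix assms(1) \<alpha>'(2) by metis
    moreover have "count_list \<alpha>' False \<le> count_list \<alpha>' True"
      using dyck_prefix[OF assms(2), of \<alpha>' "b # \<beta>"] u' \<alpha>'(1) by simp
    ultimately show False using True by simp
  next
    case False
    have "count_list (\<beta> @ [b]) False \<le> count_list (\<beta> @ [b]) True"
      using dyck_prefix[OF assms(1), of "\<beta> @ [b]" \<alpha>'] \<alpha>'(2) by simp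
    moreover have "count_list \<beta> True \<le> count_list \<beta> False"
      using dyck_suffix assms(2) u' by metis
    ultimately show False using False by simp
  qed
qed

text \<open>The number of letters \<open>True\<close> determines the unmatched letter; what remains
  is the previous lemma, applied to the difference of the two positions.\<close>

lemma dyck_snoc_rotate_inj:
  assumes "dyck u" "dyck u'" "length u' = length u"
    and "rotate p (u @ [b]) = rotate p' (u' @ [b'])"
  shows "b = b' \<and> u = u' \<and> p mod (length u + 1) = p' mod (length u + 1)"
proof -
  have main: "u = u' \<and> p = p'" if *: "dyck u" "dyck u'" "length u' = length u" "p \<le> p'" "p' \<le> length u"
    "rotate p (u @ [b]) = rotate p' (u' @ [b])" for u u' p p' b
  proof -
    have "rotate p (u @ [b]) = rotate p (rotate (p' - p) (u' @ [b]))" using * by (simp add: rotate_rotate)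
    then have r: "u @ [b] = rotate (p' - p) (u' @ [b])" unfolding rotate_inject .
    have "p' - p = 0" using dyck_snoc_rotate_eq[OF *(1-3) _ r] * by simp
    then show ?thesis using r * by simp
  qed
  have "count_list (u @ [b]) True = count_list (u' @ [b']) True"
    using assms(4) count_list_rotate by metis
  then have b: "b = b'" using dyck_length assms(1-3) by (cases b; cases b') auto
  let ?L = "length u + 1"
  have eq: "rotate (p mod ?L) (u @ [b]) = rotate (p' mod ?L) (u' @ [b])"
    using assms(3,4) b rotate_conv_mod[of p "u @ [b]"] rotate_conv_mod[of p' "u' @ [b]"] by simp
  have lt: "p mod ?L \<le> length u" "p' mod ?L \<le> length u"
    using mod_less_divisor[of ?L p] mod_less_divisor[of ?L p'] by linarith+
  have "u = u' \<and> p mod ?L = p' mod ?L"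
  proof (cases "p mod ?L \<le> p' mod ?L")
    case True
    then show ?thesis using main[OF assms(1-3) True lt(2) eq] by blast
  next
    case False
    then have "p' mod ?L \<le> p mod ?L" by simp
    then show ?thesis using main[OF assms(2,1) assms(3)[symmetric] _ _ eq[symmetric]] lt assms(3) by simp
  qed
  then show ?thesis using b by blast
qed

text \<open>Reading the circle from some \<open>True\<close> to the next \<open>False\<close>, the
  letter just before the latter is \<open>True\<close>.\<close>

lemma rotate_to_TF:
  assumes "True \<in> set xs" "False \<in> set xs"
  shows "\<exists>p ys. xs = rotate p (True # False # ys)"
proof -
  obtain a b where ab: "xs = a @ True # b" using split_list[OF assms(1)] by blast
  then have "False \<in> set (True # b @ a)" using assms(2) by auto
  then obtain d e where de: "True # b @ a = d @ False # e" "False \<notin> set d" by (metis split_list_first)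
  then have "d \<noteq> []" by auto
  then obtain d' where d': "d = d' @ [True]" using de(2) by (cases d rule: rev_cases) auto
  have "xs = rotate (length (True # b)) ((True # b) @ a)" using ab by (simp only: rotate_append)
  also have "(True # b) @ a = d' @ (True # False # e)" using de(1) d' by simp
  also have "\<dots> = rotate (length (True # False # e)) ((True # False # e) @ d')" by (simp only: rotate_append)
  finally show ?thesis by (metis append_Cons rotate_rotate)
qed

text \<open>Deleting a cyclically adjacent pair \<open>True\<close>, \<open>False\<close> does not
  change which letter stays unmatched. The induction removes such a pair and puts it back as a
  leaf.\<close>

lemma cycle_lemma_False:
  "length xs = 2 * m + 1 \<Longrightarrow> count_list xs True = m \<Longrightarrow>
     \<exists>u p. dyck u \<and> length u = 2 * m \<and> xs = rotate p (u @ [False])"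
proof (induction m arbitrary: xs)
  case 0
  then obtain x where "xs = [x]" by (cases xs) auto
  then have "xs = rotate 0 ([] @ [False])" using 0 by (cases x) auto
  then show ?case using dyck_Nil by (metis list.size(3) mult_0_right)
next
  case (Suc m)
  have "True \<in> set xs" using Suc.prems(2) count_list_0_iff by (metis nat.distinct(1))
  moreover have "count_list xs False \<noteq> 0" using Suc.prems count_list_bool[of xs] by simp
  then have "False \<in> set xs" using count_list_0_iff by metis
  ultimately obtain p ys where p: "xs = rotate p (True # False # ys)" using rotate_to_TF by blast
  then have "count_list ys True = m" "length ys = 2 * m + 1" using Suc.prems by (simp_all add: count_list_rotate)
  then obtain u q where u: "dyck u" "length u = 2 * m" "ys = rotate q (u @ [False])" using Suc.IH by blast
  \<comment> \<open>\<open>ys\<close> is the circle of \<open>u @ [False]\<close> cut before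
    position \<open>k\<close>. The deleted pair stood at this cut, so it returns into
    \<open>u\<close> at position \<open>k\<close>.\<close>
  define k where "k = q mod (2 * m + 1)"
  have k: "k \<le> length u" using mod_less_divisor[of "2 * m + 1" q] unfolding k_def u(2) by linarith
  have "ys = drop k u @ [False] @ take k u"
    using u(3) rotate_drop_take[of q "u @ [False]"] k u(2) by (simp add: k_def)
  then have "True # False # ys = (True # False # drop k u @ [False]) @ take k u" by simp
  also have "\<dots> = rotate (length (take k u)) (take k u @ (True # False # drop k u @ [False]))"
    by (simp only: rotate_append)
  finally have "xs = rotate (p + length (take k u)) ((take k u @ True # False # drop k u) @ [False])"
    using p by (simp add: rotate_rotate)
  moreover have "length (take k u @ True # False # drop k u) = 2 * Suc m" using u(2) k by simp
  ultimately show ?case using dyck_insert_TF[OF u(1) k] by blast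
qed

lemma dyck_rev_Not: "dyck u \<Longrightarrow> dyck (rev (map Not u))"
proof (induction rule: dyck.induct)
  case (dyck_node v w)
  then show ?case using dyck_append[OF _ dyck_wrap, of "rev (map Not w)" "rev (map Not v)"] by simp
qed (simp add: dyck_Nil)

text \<open>Complementing exchanges the two counts but turns Dyck words upside down; reversing in
  addition makes them Dyck words again.\<close>

lemma cycle_lemma_True:
  assumes "length xs = 2 * m + 1" "count_list xs True = m + 1"
  shows "\<exists>u p. dyck u \<and> length u = 2 * m \<and> xs = rotate p (u @ [True])"
proof -
  have cnt: "count_list (map Not ys) True = count_list ys False" for ys by (induction ys) auto
  have "count_list (rev (map Not xs)) True = m" using assms count_list_bool[of xs] by (simp add: cnt)
  then obtain u p where u: "dyck u" "length u = 2 * m" "rev (map Not xs) = rotate p (u @ [False])"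
    using cycle_lemma_False[of "rev (map Not xs)" m] assms(1) by auto
  define v where "v = rev (map Not u)"
  have "xs = rev (map Not (rev (map Not xs)))" by (simp add: rev_map comp_def)
  also have "\<dots> = map Not (rev (rotate p (u @ [False])))" unfolding u(3) by (simp add: rev_map)
  also obtain q where "rev (rotate p (u @ [False])) = rotate q (rev (u @ [False]))"
  proof -
    define Z k where "Z = u @ [False]" and "k = p mod length Z"
    have "rev (rotate p Z) = rev (take k Z) @ rev (drop k Z)" by (simp add: rotate_drop_take k_def)
    also have "\<dots> = rotate (length (rev (drop k Z))) (rev (drop k Z) @ rev (take k Z))"
      by (simp only: rotate_append)
    also have "rev (drop k Z) @ rev (take k Z) = rev Z" by (simp flip: rev_append)
    finally show thesis using that unfolding Z_def by blast
  qed
  also have "map Not (rotate q (rev (u @ [False]))) = rotate q (True # v)"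
    by (simp add: rotate_map[symmetric] v_def rev_map)
  also have "True # v = rotate (length v) (v @ [True])" using rotate_append[of v "[True]"] by simp
  finally have "xs = rotate (q + length v) (v @ [True])" by (simp add: rotate_rotate)
  moreover have "dyck v" "length v = 2 * m" using dyck_rev_Not[OF u(1)] u(2) by (simp_all add: v_def)
  ultimately show ?thesis by blast
qed

section \<open>The cycles of the 2-factor\<close>

text \<open>A sequence whose successor map is well defined and injective has no preperiod, so its
  first return to \<open>s 0\<close> closes a simple cycle. Indices start at 1 because the cycles
  will be opened between the indices 0 and 1.\<close>

lemma periodic_sequence:
  fixes s :: "nat \<Rightarrow> 'a"
  assumes step: "\<And>i j. s (Suc i) = s (Suc j) \<longleftrightarrow> s i = s j" and M: "M > 0" "s M = s 0"
  obtains N where "N > 0" "s N = s 0" "inj_on s {1..N}" "\<And>i. \<exists>j\<in>{1..N}. s i = s j"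
proof -
  have shift: "s (i + k) = s (j + k) \<longleftrightarrow> s i = s j" for i j k
    by (induction k) (simp_all add: step)
  define N where "N = (LEAST N. N > 0 \<and> s N = s 0)"
  have N: "N > 0" "s N = s 0" unfolding N_def using LeastI[of "\<lambda>N. N > 0 \<and> s N = s 0" M] M by auto
  have least: "N \<le> k" if "k > 0" "s k = s 0" for k
    unfolding N_def using that by (intro Least_le) simp
  have "s i \<noteq> s j" if "1 \<le> i" "i < j" "j \<le> N" for i j
  proof
    assume "s i = s j"
    then have "s (0 + i) = s ((j - i) + i)" using that by simp
    then have "s (j - i) = s 0" unfolding shift by simp
    then show False using least[of "j - i"] that by simp
  qed
  then have "inj_on s {1..N}" by (intro linorder_inj_onI') auto
  moreover have "\<exists>j\<in>{1..N}. s i = s j" for i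
  proof (induction i)
    case 0
    then show ?case using N by (intro bexI[of _ N]) auto
  next
    case (Suc i)
    then obtain j where j: "j \<in> {1..N}" "s i = s j" by blast
    show ?case
    proof (cases "j = N")
      case True
      then have "s (Suc i) = s (Suc 0)" using j N step by metis
      then show ?thesis using N(1) by (intro bexI[of _ 1]) auto
    next
      case False
      then show ?thesis using j step[of i j] by (intro bexI[of _ "Suc j"]) auto
    qed
  qed
  ultimately show thesis using that N by blast
qed

text \<open>
  The alternating sequence walk u False 0, walk u True 1, walk u False 1, walk u True 2, ... runs through one
  cycle of the 2-factor. The position length u * i is congruent to -i modulo length u + 1, while \<open>rot\<close> has a
  period dividing length u; since these two periods are coprime, the cycle contains all positions of all
  rotations of u.
\<close>
definition walk :: "bool list \<Rightarrow> bool \<Rightarrow> nat \<Rightarrow> bool list" where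
  "walk u b i = rotate (length u * i) ((rot ^^ i) u @ [b])"

definition up :: "bool list \<Rightarrow> bool list \<Rightarrow> bool" where
  "up xs ys \<longleftrightarrow> (\<exists>a b. xs = a @ False # b \<and> ys = a @ True # b)"

lemma up_rotate: "up xs ys \<Longrightarrow> up (rotate p xs) (rotate p ys)"
proof (induction p)
  case (Suc p)
  have "up (rotate1 xs) (rotate1 ys)" if up: "up xs ys" for xs ys
  proof -
    obtain a b where ab: "xs = a @ False # b" "ys = a @ True # b" using up unfolding up_def by blast
    show ?thesis
    proof (cases a)
      case Nil
      then show ?thesis unfolding up_def ab by (rule_tac x = b in exI) auto
    next
      case (Cons x a')
      then show ?thesis unfolding up_def ab
        by (rule_tac x = a' in exI, rule_tac x = "b @ [x]" in exI) simp
    qed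
  qed
  then show ?case using Suc by simp
qed simp

text \<open>The first of the two matchings: the unmatched letter is flipped.\<close>

lemma up_walk: "up (walk u False i) (walk u True i)"
  unfolding walk_def by (intro up_rotate) (auto simp: up_def)

lemma walk_True_Suc:
  assumes "dyck u" "u \<noteq> []"
  shows "walk u True (Suc i) = rotate (length u * i) (True # rot ((rot ^^ i) u))"
proof -
  let ?v = "(rot ^^ i) u"
  have v: "dyck ?v" "length ?v = length u" using dyck_rot_pow[OF assms] by auto
  then have "?v \<noteq> []" using assms(2) by (metis length_0_conv)
  have "walk u True (Suc i) = rotate (length u * i) (rotate (length u) (rot ?v @ [True]))"
    unfolding walk_def by (simp add: rotate_rotate add.commute)
  also have "rotate (length u) (rot ?v @ [True]) = True # rot ?v"
    using v dyck_rot[OF v(1) \<open>?v \<noteq> []\<close>] by (intro rotate_Cons_snoc) simp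
  finally show ?thesis .
qed

text \<open>The second matching: in \<open>v @ [False]\<close> the \<open>False\<close> that closes
  the first letter of \<open>v\<close> is flipped. Then that first letter is the unmatched one, and
  the word after it is \<open>rot v\<close>.\<close>

lemma up_walk_Suc:
  assumes "dyck u" "u \<noteq> []"
  shows "up (walk u False i) (walk u True (Suc i))"
proof -
  let ?v = "(rot ^^ i) u"
  have v: "dyck ?v" "length ?v = length u" using dyck_rot_pow[OF assms] by auto
  then have "?v \<noteq> []" using assms(2) by (metis length_0_conv)
  with v(1) obtain a b where ab: "dyck a" "dyck b" "?v = True # a @ False # b" by (cases rule: dyck.cases) auto
  have "walk u True (Suc i) = rotate (length u * i) (True # rot ?v)" by (rule walk_True_Suc[OF assms])
  also have "rot ?v = a @ True # b @ [False]" using ab rot_node by metis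
  finally have "walk u True (Suc i) = rotate (length u * i) ((True # a) @ True # (b @ [False]))" by simp
  moreover have "walk u False i = rotate (length u * i) ((True # a) @ False # (b @ [False]))"
    unfolding walk_def ab(3) by simp
  ultimately show ?thesis by (metis up_def up_rotate)
qed

lemma walk_eq_iff:
  assumes "dyck u" "u \<noteq> []"
  shows "walk u b i = walk u b' j \<longleftrightarrow> b = b' \<and> (rot ^^ i) u = (rot ^^ j) u \<and> (length u * i) mod (length u + 1) = (length u * j) mod (length u + 1)"
    (is "?L \<longleftrightarrow> ?R")
proof
  assume ?L
  then show ?R using dyck_snoc_rotate_inj[of "(rot ^^ i) u" "(rot ^^ j) u" "length u * i" b "length u * j" b']
    dyck_rot_pow[OF assms] unfolding walk_def by simp
next
  assume ?R
  moreover have "length ((rot ^^ j) u @ [b']) = length u + 1" using dyck_rot_pow[OF assms] by simp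
  ultimately show ?L unfolding walk_def
    using rotate_conv_mod[of "length u * i" "(rot ^^ j) u @ [b']"]
      rotate_conv_mod[of "length u * j" "(rot ^^ j) u @ [b']"] by simp
qed

lemma rot_inject:
  assumes "dyck u" "dyck v" "u \<noteq> []" "length v = length u"
  shows "rot u = rot v \<longleftrightarrow> u = v"
proof
  assume "rot u = rot v"
  moreover obtain l where l: "length u = Suc l" using assms(3) by (cases u) auto
  ultimately have "(rot ^^ Suc l) u = (rot ^^ Suc l) v" by (simp only: funpow_Suc_right comp_apply)
  then show "u = v" using rot_pow_length assms l by metis
qed simp

lemma walk_period:
  assumes "dyck u" "u \<noteq> []"
  obtains N where "N > 0" "\<And>b. walk u b N = walk u b 0" "\<And>b. walk u b (Suc N) = walk u b 1" "\<And>b. inj_on (walk u b) {1..N}"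
    "\<And>i. \<exists>j\<in>{1..N}. \<forall>b. walk u b i = walk u b j \<and> walk u b (Suc i) = walk u b (Suc j)"
proof -
  let ?L = "length u + 1"
  note iff = walk_eq_iff[OF assms]
  have b: "walk u b i = walk u b j \<longleftrightarrow> walk u False i = walk u False j" for b i j unfolding iff by simp
  have step: "walk u b (Suc i) = walk u b (Suc j) \<longleftrightarrow> walk u b i = walk u b j" for b i j
  proof -
    have "(rot ^^ Suc i) u = (rot ^^ Suc j) u \<longleftrightarrow> (rot ^^ i) u = (rot ^^ j) u"
      using dyck_rot_pow[OF assms, of i] dyck_rot_pow[OF assms, of j] assms(2) rot_inject
      by (metis comp_apply funpow.simps(2) length_0_conv)
    moreover have "(length u + k) mod ?L = (length u + l) mod ?L \<longleftrightarrow> k mod ?L = l mod ?L" for k l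
    proof
      assume "(length u + k) mod ?L = (length u + l) mod ?L"
      then have "Suc (length u + k) mod ?L = Suc (length u + l) mod ?L" by (metis mod_Suc_eq)
      then have "(k + ?L) mod ?L = (l + ?L) mod ?L" by (simp add: add.commute)
      then show "k mod ?L = l mod ?L" unfolding mod_add_self2 .
    qed (metis mod_add_right_eq)
    ultimately show ?thesis unfolding iff by simp
  qed
  note rl = rot_pow_mult_length[OF assms(1)]
  have "walk u False (?L * length u) = walk u False 0"
    unfolding iff by (simp add: rl del: mult_Suc)
  then obtain N where N: "N > 0" "walk u False N = walk u False 0" "inj_on (walk u False) {1..N}"
    "\<And>i. \<exists>j\<in>{1..N}. walk u False i = walk u False j"
    using periodic_sequence[of "walk u False" "?L * length u"] step assms(2) by auto
  show thesis
  proof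
    show "inj_on (walk u b) {1..N}" for b using N(3) b unfolding inj_on_def by blast
    show "\<exists>j\<in>{1..N}. \<forall>b. walk u b i = walk u b j \<and> walk u b (Suc i) = walk u b (Suc j)" for i
      using N(4)[of i] b step by blast
    show *: "walk u b N = walk u b 0" for b using N(2) b by blast
    show "walk u b (Suc N) = walk u b 1" for b using * step[of b N 0] by simp
  qed (fact N(1))
qed

lemma walk_reaches:
  assumes "dyck u" "u \<noteq> []" "v \<in> orbit_rot u"
  shows "\<exists>i. (rot ^^ i) u = v \<and> (length u * i) mod (length u + 1) = p mod (length u + 1)"
proof -
  obtain a where a: "v = (rot ^^ a) u" using assms(3) unfolding orbit_rot_def by blast
  obtain l where l: "length u = Suc l" using assms(2) by (cases u) auto
  note rl = rot_pow_mult_length[OF assms(1)]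
  \<comment> \<open>\<open>length u\<close> is -1 modulo \<open>length u + 1\<close>, so index
    \<open>i\<close> has position -i, which is -a + (p + a) = p for this choice; the multiple of
    \<open>length u\<close> does not move the tree.\<close>
  define i where "i = a + (p + a) * length u"
  have "(rot ^^ i) u = v" unfolding i_def a funpow_add comp_apply rl ..
  moreover have "length u * i = p + (l * p + length u * a) * (length u + 1)"
    unfolding i_def l by (simp add: algebra_simps)
  then have "(length u * i) mod (length u + 1) = p mod (length u + 1)" by (simp only: mod_mult_self1)
  ultimately show ?thesis by blast
qed

definition up_edges :: "bool list set set" where
  "up_edges = {{xs, ys} | xs ys. up xs ys}"

lemma up_edgesI: "up xs ys \<Longrightarrow> {xs, ys} \<in> up_edges" "up xs ys \<Longrightarrow> {ys, xs} \<in> up_edges"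
  unfolding up_edges_def by (auto simp: insert_commute)

definition orbit_verts :: "bool list set \<Rightarrow> bool list set" where
  "orbit_verts C = {rotate p (v @ [b]) | p v b. v \<in> C}"

definition walk_verts :: "bool list \<Rightarrow> nat \<Rightarrow> nat \<Rightarrow> bool list set" where
  "walk_verts u i j = walk u False ` {i..j} \<union> walk u True ` {i..j}"

definition walk_edges :: "bool list \<Rightarrow> nat \<Rightarrow> nat \<Rightarrow> bool list set set" where
  "walk_edges u = alt_edges (walk u False) (walk u True)"

lemma ham_path_walk:
  assumes "dyck u" "u \<noteq> []" "i \<le> j" "\<And>b. inj_on (walk u b) {i..j}"
  shows "ham_path (walk_verts u i j) (walk_edges u i j) (walk u True i) (walk u False j)"
  unfolding walk_verts_def walk_edges_def
  by (rule ham_path_alternating) (use assms in \<open>auto simp: walk_eq_iff\<close>)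

lemma walk_edges_up:
  "dyck u \<Longrightarrow> u \<noteq> [] \<Longrightarrow> walk_edges u i j \<subseteq> up_edges"
  unfolding walk_edges_def alt_edges_def using up_walk up_walk_Suc up_edgesI by blast

lemma orbit_verts_walk:
  assumes u: "dyck u" "u \<noteq> []"
    and N: "\<And>i. \<exists>j\<in>{1..N}. \<forall>b. walk u b i = walk u b j \<and> walk u b (Suc i) = walk u b (Suc j)"
  shows "orbit_verts (orbit_rot u) = walk_verts u 1 N"
proof
  show "walk_verts u 1 N \<subseteq> orbit_verts (orbit_rot u)"
    unfolding walk_verts_def orbit_verts_def walk_def orbit_rot_def by auto
  show "orbit_verts (orbit_rot u) \<subseteq> walk_verts u 1 N"
  proof
    fix x assume "x \<in> orbit_verts (orbit_rot u)"
    then obtain p v b where x: "x = rotate p (v @ [b])" "v \<in> orbit_rot u" unfolding orbit_verts_def by blast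
    obtain i where i: "(rot ^^ i) u = v" "(length u * i) mod (length u + 1) = p mod (length u + 1)"
      using walk_reaches[OF u x(2)] by blast
    have "length (v @ [b]) = length u + 1" using i(1) dyck_rot_pow[OF u, of i] by simp
    then have "x = walk u b i" unfolding x(1) walk_def i(1)
      using i(2) rotate_conv_mod[of p "v @ [b]"] rotate_conv_mod[of "length u * i" "v @ [b]"] by simp
    moreover obtain j where "j \<in> {1..N}" "walk u b i = walk u b j" using N by blast
    ultimately show "x \<in> walk_verts u 1 N" unfolding walk_verts_def by (cases b) auto
  qed
qed

text \<open>These edges of the second matching, one for each rooting \<open>v\<close> of the tree,
  are the ones that a cycle can offer to its children for switching.\<close>

lemma walk_at:
  assumes u: "dyck u" "u \<noteq> []"
    and N: "\<And>i. \<exists>j\<in>{1..N}. \<forall>b. walk u b i = walk u b j \<and> walk u b (Suc i) = walk u b (Suc j)"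
    and v: "v \<in> orbit_rot u"
  shows "\<exists>j\<in>{1..N}. walk u False j = v @ [False] \<and> walk u True (Suc j) = True # rot v"
proof -
  obtain i where i: "(rot ^^ i) u = v" "(length u * i) mod (length u + 1) = 0 mod (length u + 1)"
    using walk_reaches[OF u v] by blast
  have "v \<noteq> []" "dyck v" and len: "length v = length u" using i(1) dyck_rot_pow[OF u, of i] u(2) by auto
  then have lr: "length (rot v) = length u" using dyck_rot by simp
  have "walk u False i = v @ [False]" unfolding walk_def i(1) using i(2) len by (intro rotate_id) simp
  moreover have "walk u True (Suc i) = True # rot v"
    unfolding walk_True_Suc[OF u] i(1) using i(2) lr by (intro rotate_id) simp
  moreover obtain j where "j \<in> {1..N}" "walk u False i = walk u False j" "walk u True (Suc i) = walk u True (Suc j)"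
    using N by blast
  ultimately show ?thesis by metis
qed

lemma orbit_ham_cycle:
  assumes u: "dyck u" "u \<noteq> []"
  shows "\<exists>D \<subseteq> up_edges. ham_cycle (orbit_verts (orbit_rot u)) D \<and>
    (\<forall>v\<in>orbit_rot u. {v @ [False], True # rot v} \<in> D)"
proof -
  obtain N where N: "N > 0" "\<And>b. walk u b (Suc N) = walk u b 1" "\<And>b. inj_on (walk u b) {1..N}"
    "\<And>i. \<exists>j\<in>{1..N}. \<forall>b. walk u b i = walk u b j \<and> walk u b (Suc i) = walk u b (Suc j)"
    "\<And>b. walk u b N = walk u b 0"
    using walk_period[OF u] by metis
  define D where "D = insert {walk u False N, walk u True 1} (walk_edges u 1 N)"
  have V: "orbit_verts (orbit_rot u) = walk_verts u 1 N" using orbit_verts_walk[OF u N(4)] .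
  have P: "ham_path (walk_verts u 1 N) (walk_edges u 1 N) (walk u True 1) (walk u False N)"
    using ham_path_walk[OF u _ N(3)] N(1) by simp
  \<comment> \<open>A period 1 would give a single edge instead of a cycle; it is excluded since
    \<open>length u\<close> is not 0 modulo \<open>length u + 1\<close>.\<close>
  have "N \<noteq> 1" using N(5)[of False] u(2) unfolding walk_eq_iff[OF u] by (cases "length u") (auto dest!: mod_0_imp_dvd dvd_imp_le)
  have "card (walk_verts u 1 N) = card (walk u False ` {1..N}) + card (walk u True ` {1..N})"
    unfolding walk_verts_def by (rule card_Un_disjoint) (auto simp: walk_eq_iff[OF u])
  also have "\<dots> = N + N" using N(3) by (simp add: card_image)
  finally have "3 \<le> card (walk_verts u 1 N)" using N(1) \<open>N \<noteq> 1\<close> by simp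
  from ham_path_close[OF P this] have "ham_cycle (walk_verts u 1 N) D" unfolding D_def .
  moreover have "D \<subseteq> up_edges"
    unfolding D_def using walk_edges_up[OF u] up_walk_Suc[OF u, of N] N(2) by (auto intro: up_edgesI)
  moreover have "{v @ [False], True # rot v} \<in> D" if v: "v \<in> orbit_rot u" for v
  proof -
    obtain j where j: "j \<in> {1..N}" "walk u False j = v @ [False]" "walk u True (Suc j) = True # rot v"
      using walk_at[OF u N(4) v] by blast
    show ?thesis
    proof (cases "j = N")
      case True
      then show ?thesis unfolding D_def using j N(2) by simp
    next
      case False
      then have "j \<in> {1..<N}" using j by simp
      then show ?thesis unfolding D_def walk_edges_def alt_edges_def j(2,3)[symmetric] by blast
    qed
  qed
  ultimately show ?thesis unfolding V by blast
qed

text \<open>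
  The path avoids the edges from walk u False 0 to walk u True 1 and from walk u True 3 to walk u False 3
  of the cycle of u, and uses instead the edge between walk u True 1 and walk u False 3, which belongs to
  the 6-cycle obtained by varying the letters at three positions.
\<close>
lemma orbit_ham_path:
  assumes v: "dyck v" and w: "dyck w"
  defines "u \<equiv> True # True # False # v @ False # w"
  shows "\<exists>D \<subseteq> up_edges.
    ham_path (orbit_verts (orbit_rot u)) D (True # False # True # v @ True # w @ [False]) (u @ [False]) \<and>
    (\<forall>x\<in>orbit_rot u. x \<noteq> u \<longrightarrow> {x @ [False], True # rot x} \<in> D)"
proof -
  have TFv: "dyck (True # False # v)" using dyck_node[OF dyck_Nil v] by simp
  have u: "dyck u" "u \<noteq> []" using dyck_node[OF TFv w] unfolding u_def by simp_all
  obtain N where N: "N > 0" "\<And>b. walk u b (Suc N) = walk u b 1" "\<And>b. inj_on (walk u b) {1..N}"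
    "\<And>i. \<exists>j\<in>{1..N}. \<forall>b. walk u b i = walk u b j \<and> walk u b (Suc i) = walk u b (Suc j)"
    "\<And>b. walk u b N = walk u b 0"
    using walk_period[OF u] by metis
  have "even (length u)" using dyck_length[OF u(1)] by simp
  then have len: "length u \<ge> 4" unfolding u_def by simp
  \<comment> \<open>Indices 1, 2, 3 and 4 must be distinct in the period. Since
    \<open>length u\<close> and \<open>length u + 1\<close> are coprime, \<open>N\<close> is a
    multiple of \<open>length u + 1\<close>, which is at least 5.\<close>
  have N4: "N \<ge> 4"
  proof (rule ccontr)
    assume "\<not> N \<ge> 4"
    then have lt: "N < 4" by simp
    have dvd: "length u + 1 dvd length u * N"
      using N(5)[of False] unfolding walk_eq_iff[OF u] by (simp add: dvd_eq_mod_eq_0)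
    have "coprime (length u + 1) (length u)" by simp
    then have "length u + 1 dvd N" using dvd by (simp add: coprime_dvd_mult_right_iff)
    then show False using len dvd_imp_le[of "length u + 1" N] N(1) lt by auto
  qed
  have N4': "inj_on (walk u b) A" if "A \<subseteq> {1..N}" for A b using N(3) that inj_on_subset by blast
  have V: "orbit_verts (orbit_rot u) = walk_verts u 1 N" using orbit_verts_walk[OF u N(4)] .
  have neq: "walk u b i \<noteq> walk u b' j" if "i \<in> {1..N}" "j \<in> {1..N}" "b \<noteq> b' \<or> i \<noteq> j" for b b' i j
    using that N(3)[of b] unfolding inj_on_def by (metis walk_eq_iff[OF u])

  have r1: "rot u = True # False # v @ True # w @ [False]"
    using rot_node[OF TFv w] unfolding u_def by simp
  have r3: "(rot ^^ 3) u = v @ True # w @ False # True # [False]"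
  proof -
    have "(rot ^^ 3) u = (rot ^^ 2) (rot u)" by (simp add: numeral_2_eq_2 numeral_3_eq_3)
    also have "\<dots> = (rot ^^ length [True, False]) ([True, False] @ (v @ True # w @ [False]))"
      unfolding r1 by (simp add: numeral_2_eq_2)
    also have "\<dots> = (v @ True # w @ [False]) @ [True, False]"
      by (intro rot_pow_append dyck_TF dyck_append v dyck_wrap w)
    finally show ?thesis by simp
  qed
  have w0: "walk u False N = u @ [False]" using N(5)[of False] by (simp add: walk_def[of u _ 0])
  have w1: "walk u True 1 = True # True # False # v @ True # w @ [False]"
    using walk_True_Suc[OF u, of 0] r1 by simp
  \<comment> \<open>The position \<open>length u * 3\<close> is -3 modulo the word length, so the
    last three letters of \<open>(rot ^^ 3) u @ [b]\<close> move to the front.\<close>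
  have w3: "walk u b 3 = True # False # b # v @ True # w @ [False]" for b
  proof -
    let ?s = "v @ True # w @ [False]"
    have "walk u b 3 = rotate (length u * 3) (?s @ [True, False, b])" unfolding walk_def r3 by simp
    also have "\<dots> = rotate ((length u * 3) mod (length u + 1)) (?s @ [True, False, b])"
      using rotate_conv_mod[of "length u * 3" "?s @ [True, False, b]"] unfolding u_def by simp
    also have "length u * 3 = (length u - 2) + 2 * (length u + 1)" using len by simp
    also have "\<dots> mod (length u + 1) = length u - 2" unfolding mod_mult_self1 by simp
    also have "length u - 2 = length ?s" unfolding u_def by simp
    finally show ?thesis unfolding rotate_append by simp
  qed

  \<comment> \<open>The one edge of the 6-cycle that is new and joins two vertices of this
    orbit.\<close>
  have e13: "up (walk u False 3) (walk u True 1)" unfolding w1 w3 up_def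
    by (rule_tac x = "[True]" in exI) simp

  \<comment> \<open>The path runs backwards from \<open>walk u True 3\<close> to
    \<open>walk u True 1\<close>, jumps to \<open>walk u False 3\<close>, and continues forwards to
    \<open>walk u False N\<close>.\<close>
  let ?D1 = "insert {walk u False 2, walk u True 3} (walk_edges u 1 2 \<union> {})"
  have "ham_path (walk_verts u 1 2 \<union> {walk u True 3}) ?D1 (walk u True 1) (walk u True 3)"
  proof (rule ham_path_join)
    show "ham_path (walk_verts u 1 2) (walk_edges u 1 2) (walk u True 1) (walk u False 2)"
      using N4 by (intro ham_path_walk u N4') auto
    show "walk_verts u 1 2 \<inter> {walk u True 3} = {}" unfolding walk_verts_def using neq N4 by auto
  qed (rule ham_path_singleton)
  then have A: "ham_path (walk_verts u 1 2 \<union> {walk u True 3}) ?D1 (walk u True 3) (walk u True 1)"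
    by (rule ham_path_sym)
  let ?D2 = "insert {walk u False 3, walk u True 4} ({} \<union> walk_edges u 4 N)"
  have B: "ham_path ({walk u False 3} \<union> walk_verts u 4 N) ?D2 (walk u False 3) (walk u False N)"
  proof (rule ham_path_join)
    show "ham_path (walk_verts u 4 N) (walk_edges u 4 N) (walk u True 4) (walk u False N)"
      using N4 by (intro ham_path_walk u N4') auto
    show "{walk u False 3} \<inter> walk_verts u 4 N = {}" unfolding walk_verts_def using neq N4 by auto
  qed (rule ham_path_singleton)
  define D where "D = insert {walk u True 1, walk u False 3} (?D1 \<union> ?D2)"
  have "(walk_verts u 1 2 \<union> {walk u True 3}) \<inter> ({walk u False 3} \<union> walk_verts u 4 N) = {}"
    unfolding walk_verts_def using neq N4 by auto
  from ham_path_join[OF A B this]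
  have "ham_path ((walk_verts u 1 2 \<union> {walk u True 3}) \<union> ({walk u False 3} \<union> walk_verts u 4 N)) D
    (walk u True 3) (walk u False N)" unfolding D_def .
  then have path: "ham_path ((walk_verts u 1 2 \<union> {walk u True 3}) \<union> ({walk u False 3} \<union> walk_verts u 4 N)) D
    (True # False # True # v @ True # w @ [False]) (u @ [False])" unfolding w0 w3 .
  have verts: "(walk_verts u 1 2 \<union> {walk u True 3}) \<union> ({walk u False 3} \<union> walk_verts u 4 N) = walk_verts u 1 N"
  proof -
    have "{1..N} = {1..2} \<union> {3} \<union> {4..N}" using N4 by auto
    then show ?thesis unfolding walk_verts_def by (simp only: image_Un image_insert image_empty) blast
  qed
  have "D \<subseteq> up_edges"
    unfolding D_def using walk_edges_up[OF u] up_edgesI e13 up_walk_Suc[OF u, of 2] up_walk_Suc[OF u, of 3] by auto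
  moreover have "{x @ [False], True # rot x} \<in> D" if x: "x \<in> orbit_rot u" "x \<noteq> u" for x
  proof -
    obtain j where j: "j \<in> {1..N}" "walk u False j = x @ [False]" "walk u True (Suc j) = True # rot x"
      using walk_at[OF u N(4) x(1)] by blast
    \<comment> \<open>Among the edges of the second matching only the one at index \<open>N\<close>,
      belonging to \<open>u\<close> itself, has been given up; the other lost edge belongs to the
      first matching.\<close>
    have "j \<noteq> N" using w0 j x(2) by auto
    then have "j = 1 \<or> j = 2 \<or> j = 3 \<or> j \<in> {4..<N}" using j(1) by auto
    then show ?thesis unfolding D_def walk_edges_def alt_edges_def j(2,3)[symmetric] by auto
  qed
  ultimately show ?thesis using path unfolding V verts by blast
qed

section \<open>Joining the cycles of the 2-factor\<close>

lemma orbit_verts_disjoint: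
  assumes "dyck u" "dyck v" "u \<noteq> []" "length v = length u" "orbit_rot u \<noteq> orbit_rot v"
  shows "orbit_verts (orbit_rot u) \<inter> orbit_verts (orbit_rot v) = {}"
proof (rule ccontr)
  assume "orbit_verts (orbit_rot u) \<inter> orbit_verts (orbit_rot v) \<noteq> {}"
  then obtain x p a b p' a' b' where x: "x = rotate p (a @ [b])" "a \<in> orbit_rot u"
    "x = rotate p' (a' @ [b'])" "a' \<in> orbit_rot v"
    unfolding orbit_verts_def by blast
  have v: "v \<noteq> []" using assms(3,4) by auto
  have "dyck a \<and> length a = length u" "dyck a' \<and> length a' = length v"
    using x(2,4) dyck_rot_pow[OF assms(1,3)] dyck_rot_pow[OF assms(2) v] unfolding orbit_rot_def by auto
  then have "a = a'" using dyck_snoc_rotate_inj[OF _ _ _ x(3)[unfolded x(1)]] assms(4) by simp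
  then show False using orbit_rot_eq[OF assms(1,3) x(2)] orbit_rot_eq[OF assms(2) v x(4)] assms(5) by simp
qed

lemma orbit_verts_cover:
  assumes "m > 0"
  shows "(\<Union>C \<in> orbit_rot ` {u. dyck u \<and> length u = 2 * m}. orbit_verts C)
    = {xs. length xs = 2 * m + 1 \<and> count_list xs True \<in> {m, m + 1}}" (is "?L = ?R")
proof
  show "?L \<subseteq> ?R"
  proof
    fix x assume "x \<in> ?L"
    then obtain u v p b where u: "dyck u" "length u = 2 * m" "v \<in> orbit_rot u" "x = rotate p (v @ [b])"
      unfolding orbit_verts_def by blast
    have "u \<noteq> []" using u(2) assms by auto
    then have v: "dyck v" "length v = 2 * m"
      using u(2,3) dyck_rot_pow[OF u(1)] unfolding orbit_rot_def by auto
    then have "count_list v True = m" using dyck_length by fastforce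
    then show "x \<in> ?R" unfolding u(4) using v by (cases b) (simp_all add: count_list_rotate)
  qed
  show "?R \<subseteq> ?L"
  proof
    fix x assume "x \<in> ?R"
    then have "\<exists>u p b. dyck u \<and> length u = 2 * m \<and> x = rotate p (u @ [b])"
      using cycle_lemma_False[of x m] cycle_lemma_True[of x m] by blast
    then show "x \<in> ?L" unfolding orbit_verts_def using orbit_rot_self by blast
  qed
qed

text \<open>The rooting of least weight is pulled. The result bounds the minimum over its own orbit
  from above, so the minimum drops even if other rootings of the new tree are lighter. Only the star
  admits no pull.\<close>

lemma pull_orbit:
  assumes "dyck u" "u \<noteq> []" "orbit_rot u \<noteq> orbit_rot (concat (replicate m [True, False]))" "length u = 2 * m"
  shows "\<exists>v w. dyck v \<and> dyck w \<and> True # True # False # v @ False # w \<in> orbit_rot u \<and>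
    (LEAST k. k \<in> weight ` orbit_rot (True # False # True # v @ False # w)) < (LEAST k. k \<in> weight ` orbit_rot u)"
proof -
  have "weight u \<in> weight ` orbit_rot u" using orbit_rot_self by blast
  then have "(LEAST k. k \<in> weight ` orbit_rot u) \<in> weight ` orbit_rot u" by (rule LeastI)
  then obtain x where x: "x \<in> orbit_rot u" "weight x = (LEAST k. k \<in> weight ` orbit_rot u)" by auto
  have dx: "dyck x" "length x = 2 * m"
    using x(1) assms(4) dyck_rot_pow[OF assms(1,2)] unfolding orbit_rot_def by auto
  have ox: "orbit_rot x = orbit_rot u" using orbit_rot_eq[OF assms(1,2) x(1)] .
  have "\<exists>y. pull x y"
  proof (rule ccontr)
    assume "\<not> ?thesis"
    then obtain n where n: "x = concat (replicate n [True, False])" using pull_or_star[OF dx(1)] by blast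
    have "length (concat (replicate n [True, False])) = 2 * n" by (induction n) auto
    then have "n = m" using n dx(2) by simp
    then show False using n ox assms(3) by simp
  qed
  then obtain y where y: "pull x y" ..
  obtain j v w where jvw: "dyck v" "dyck w" "(rot ^^ j) x = True # True # False # v @ False # w"
      "(rot ^^ j) y = True # False # True # v @ False # w"
    using pull_rot[OF y dyck_Nil] by auto
  have dy: "dyck y" "y \<noteq> []" using pull_dyck[OF y] pull_length[OF y] dx(2) assms(2,4) by auto
  have "(rot ^^ j) y \<in> orbit_rot y" unfolding orbit_rot_def by blast
  then have "orbit_rot ((rot ^^ j) y) = orbit_rot y" by (rule orbit_rot_eq[OF dy])
  then have "weight y \<in> weight ` orbit_rot ((rot ^^ j) y)" using orbit_rot_self by blast
  then have "(LEAST k. k \<in> weight ` orbit_rot ((rot ^^ j) y)) \<le> weight y" by (rule Least_le)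
  also have "\<dots> < (LEAST k. k \<in> weight ` orbit_rot u)" using pull_weight[OF y] x(2) by simp
  finally have "(LEAST k. k \<in> weight ` orbit_rot (True # False # True # v @ False # w)) < (LEAST k. k \<in> weight ` orbit_rot u)"
    unfolding jvw(4) .
  moreover have "(rot ^^ j) x \<in> orbit_rot x" unfolding orbit_rot_def by blast
  ultimately show ?thesis using jvw ox by (intro exI[of _ v] exI[of _ w]) simp
qed

text \<open>Why the switches do not interfere: the edge between \<open>x @ [False]\<close> and
  \<open>True # rot x\<close> is given up by the path of \<open>C\<close> only for
  \<open>x = h C\<close>, which starts with \<open>True\<close>, \<open>True\<close>,
  \<open>False\<close>, and it is lent to a child \<open>C'\<close> only for
  \<open>x = l C'\<close>, which starts with \<open>True\<close>, \<open>False\<close>,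
  \<open>True\<close>. Moreover \<open>l C'\<close> determines \<open>fv C'\<close> and
  \<open>fw C'\<close>, hence \<open>C'\<close>, so no edge is lent twice.\<close>

lemma middle_levels:
  assumes "m > 0"
  shows "\<exists>F \<subseteq> up_edges. ham_cycle {xs. length xs = 2 * m + 1 \<and> count_list xs True \<in> {m, m + 1}} F"
proof -
  define U where "U = {u. dyck u \<and> length u = 2 * m}"
  define star where "star = concat (replicate m [True, False])"
  define I where "I = orbit_rot ` U"
  define r where "r = orbit_rot star"
  define rank where "rank C = (LEAST k. k \<in> weight ` C)" for C
  define hi where "hi v w = True # True # False # v @ False # w" for v w :: "bool list"
  define lo where "lo v w = True # False # True # v @ False # w" for v w :: "bool list"
  have U: "dyck u" "length u = 2 * m" "u \<noteq> []" if "u \<in> U" for u using that assms unfolding U_def by auto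
  have "dyck (concat (replicate n [True, False])) \<and> length (concat (replicate n [True, False])) = 2 * n" for n
    by (induction n) (auto intro: dyck_Nil dyck_append[OF dyck_TF, simplified])
  then have star: "star \<in> U" unfolding star_def U_def by blast
  have ex: "\<exists>v w. dyck v \<and> dyck w \<and> hi v w \<in> C \<and> rank (orbit_rot (lo v w)) < rank C" if "C \<in> I" "C \<noteq> r" for C
  proof -
    obtain u where u: "u \<in> U" "C = orbit_rot u" using \<open>C \<in> I\<close> unfolding I_def by blast
    show ?thesis using pull_orbit[OF U(1,3)[OF u(1)] _ U(2)[OF u(1)]] that(2)
      unfolding u(2) r_def star_def rank_def hi_def lo_def .
  qed
  then obtain fv fw where fvw: "\<And>C. C \<in> I \<Longrightarrow> C \<noteq> r \<Longrightarrow> dyck (fv C) \<and> dyck (fw C) \<and> hi (fv C) (fw C) \<in> C \<and>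
      rank (orbit_rot (lo (fv C) (fw C))) < rank C" by metis
  define h where "h C = hi (fv C) (fw C)" for C
  define l where "l C = lo (fv C) (fw C)" for C
  have mem: "x \<in> U \<and> C = orbit_rot x" if C: "C \<in> I" and x: "x \<in> C" for C x
  proof -
    obtain u where u: "u \<in> U" "C = orbit_rot u" using C unfolding I_def by blast
    then have "x \<in> U" using x dyck_rot_pow[OF U(1,3)[OF u(1)]] U(2)[OF u(1)] unfolding orbit_rot_def U_def by auto
    then show ?thesis using orbit_rot_eq[OF U(1,3)[OF u(1)]] u x by blast
  qed
  have hU: "h C \<in> U" "C = orbit_rot (h C)" if "C \<in> I" "C \<noteq> r" for C
    using mem[OF that(1)] fvw[OF that] unfolding h_def by auto
  have lU: "l C \<in> U" "orbit_rot (l C) \<in> I" if "C \<in> I" "C \<noteq> r" for C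
  proof -
    have "dyck (True # [] @ False # True # fv C @ False # fw C)"
      using fvw[OF that] by (intro dyck_node dyck_Nil) auto
    moreover have "length (h C) = 2 * m" using hU(1)[OF that] by (rule U(2))
    ultimately show "l C \<in> U" unfolding U_def l_def h_def lo_def hi_def by simp
    then show "orbit_rot (l C) \<in> I" unfolding I_def by blast
  qed
  \<comment> \<open>At the second letter, the third letter and the letter after \<open>fv C\<close>,
    the 6-cycle reads FTF (\<open>l C @ [False]\<close>), FTT (\<open>fz C\<close>), FFT, TFT, TFF
    (\<open>h C @ [False]\<close>), TTF (\<open>True # rot (l C)\<close>). The first and the last
    word lie on the parent cycle, the other four on that of \<open>C\<close>.\<close>
  define fz where "fz C = True # False # True # fv C @ True # fw C @ [False]" for C
  have cyc: "\<exists>D \<subseteq> up_edges. ham_cycle (orbit_verts r) D \<and> (\<forall>v\<in>r. {v @ [False], True # rot v} \<in> D)"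
    unfolding r_def using orbit_ham_cycle[OF U(1,3)[OF star]] .
  have path: "\<exists>D \<subseteq> up_edges. ham_path (orbit_verts C) D (fz C) (h C @ [False]) \<and>
    (\<forall>x\<in>C. x \<noteq> h C \<longrightarrow> {x @ [False], True # rot x} \<in> D)" if C: "C \<in> I" "C \<noteq> r" for C
  proof -
    have "orbit_rot (True # True # False # fv C @ False # fw C) = C"
      using hU(2)[OF C] unfolding h_def hi_def by simp
    then show ?thesis using orbit_ham_path[of "fv C" "fw C"] fvw[OF C] unfolding fz_def h_def hi_def by auto
  qed
  define good where "good C D \<longleftrightarrow> D \<subseteq> up_edges \<and> (C = r \<longrightarrow> ham_cycle (orbit_verts C) D) \<and>
     (C \<noteq> r \<longrightarrow> ham_path (orbit_verts C) D (fz C) (h C @ [False])) \<and>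
     (\<forall>x\<in>C. C = r \<or> x \<noteq> h C \<longrightarrow> {x @ [False], True # rot x} \<in> D)" for C D
  have "\<exists>D. good C D" if "C \<in> I" for C
  proof (cases "C = r")
    case True
    obtain D where "D \<subseteq> up_edges" "ham_cycle (orbit_verts r) D" "\<forall>v\<in>r. {v @ [False], True # rot v} \<in> D"
      using cyc by blast
    then have "good C D" unfolding good_def True by simp
    then show ?thesis ..
  next
    case False
    then obtain D where "D \<subseteq> up_edges" "ham_path (orbit_verts C) D (fz C) (h C @ [False])"
      "\<forall>x\<in>C. x \<noteq> h C \<longrightarrow> {x @ [False], True # rot x} \<in> D"
      using path[OF \<open>C \<in> I\<close>] by blast
    then have "good C D" unfolding good_def using False by simp
    then show ?thesis ..
  qed
  then obtain D where good: "\<And>C. C \<in> I \<Longrightarrow> good C (D C)" by metis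
  have D: "\<And>C. C \<in> I \<Longrightarrow> D C \<subseteq> up_edges"
    and Dr: "r \<in> I \<Longrightarrow> ham_cycle (orbit_verts r) (D r)" "\<And>v. r \<in> I \<Longrightarrow> v \<in> r \<Longrightarrow> {v @ [False], True # rot v} \<in> D r"
    and DC: "\<And>C. C \<in> I \<Longrightarrow> C \<noteq> r \<Longrightarrow> ham_path (orbit_verts C) (D C) (fz C) (h C @ [False])"
      "\<And>C x. C \<in> I \<Longrightarrow> C \<noteq> r \<Longrightarrow> x \<in> C \<Longrightarrow> x \<noteq> h C \<Longrightarrow> {x @ [False], True # rot x} \<in> D C"
    using good unfolding good_def by simp_all
  have rotl: "rot (l C) = True # True # fv C @ False # fw C @ [False]" if "C \<in> I" "C \<noteq> r" for C
    using rot_node[OF dyck_Nil dyck_node, of "fv C" "fw C"] fvw[OF that] unfolding l_def lo_def by simp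
  have "\<exists>F \<subseteq> up_edges. ham_cycle (\<Union>C\<in>I. orbit_verts C) F"
  proof (rule ham_cycle_glue_tree[where par = "\<lambda>C. orbit_rot (l C)" and rank = rank and r = r and D = D
        and c = fz and d = "\<lambda>C. h C @ [False]" and a = "\<lambda>C. l C @ [False]" and b = "\<lambda>C. True # rot (l C)"])
    have "finite U" unfolding U_def
      using finite_lists_length_eq[of "UNIV :: bool set" "2 * m"] by (auto elim: finite_subset[rotated])
    then show "finite I" unfolding I_def by simp
    show rI: "r \<in> I" unfolding I_def r_def using star by blast
    show "orbit_rot (l C) \<in> I \<and> rank (orbit_rot (l C)) < rank C" if "C \<in> I" "C \<noteq> r" for C
      using lU[OF that] fvw[OF that] unfolding l_def by blast
    show "orbit_verts C \<inter> orbit_verts C' = {}" if C: "C \<in> I" "C' \<in> I" "C \<noteq> C'" for C C'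
    proof -
      obtain u u' where u: "u \<in> U" "C = orbit_rot u" "u' \<in> U" "C' = orbit_rot u'" using C unfolding I_def by blast
      then show ?thesis using orbit_verts_disjoint[of u u'] U C(3) by metis
    qed
    show "ham_cycle (orbit_verts r) (D r)" using Dr rI by blast
    show "ham_path (orbit_verts C) (D C) (fz C) (h C @ [False])" if "C \<in> I" "C \<noteq> r" for C using DC that by blast
    show "{l C @ [False], True # rot (l C)} \<in> D (orbit_rot (l C))" if C: "C \<in> I" "C \<noteq> r" for C
    proof (cases "orbit_rot (l C) = r")
      case True
      then show ?thesis using Dr(2)[OF rI] orbit_rot_self by metis
    next
      case False
      have "l C \<noteq> h (orbit_rot (l C))" unfolding l_def h_def lo_def hi_def by simp
      then show ?thesis using DC(2)[OF lU(2)[OF C] False orbit_rot_self] by blast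
    qed
    show "C = C'" if C: "C \<in> I" "C' \<in> I" "C \<noteq> r" "C' \<noteq> r"
      and eq: "{l C @ [False], True # rot (l C)} = {l C' @ [False], True # rot (l C')}" for C C'
    proof -
      have "l C' @ [False] \<noteq> True # rot (l C)"
        using rotl[OF C(1,3)] by (simp add: l_def[of C'] lo_def)
      then have "l C = l C'" using eq by (auto simp: doubleton_eq_iff)
      then have "fv C @ False # fw C = fv C' @ False # fw C'" unfolding l_def lo_def by simp
      then have "fv C = fv C' \<and> fw C = fw C'"
        using fvw[OF C(1,3)] fvw[OF C(2,4)] dyck_first_return_unique by blast
      then have "h C = h C'" unfolding h_def by simp
      then show "C = C'" using hU(2) C by metis
    qed
    show "D C \<subseteq> up_edges" if "C \<in> I" for C using D[OF that] .
    show "{l C @ [False], fz C} \<in> up_edges \<and> {True # rot (l C), h C @ [False]} \<in> up_edges"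
      if C: "C \<in> I" "C \<noteq> r" for C
    proof
      have "up (l C @ [False]) (fz C)" unfolding up_def l_def lo_def fz_def
        by (rule_tac x = "True # False # True # fv C" in exI, rule_tac x = "fw C @ [False]" in exI) simp
      then show "{l C @ [False], fz C} \<in> up_edges" by (rule up_edgesI)
      have "up (h C @ [False]) (True # rot (l C))" unfolding rotl[OF C] up_def h_def hi_def
        by (rule_tac x = "[True, True]" in exI) simp
      then show "{True # rot (l C), h C @ [False]} \<in> up_edges" by (rule up_edgesI)
    qed
  qed
  then show ?thesis using orbit_verts_cover[OF assms] unfolding I_def U_def by simp
qed

section \<open>Cycles with chains\<close>

definition level :: "nat \<Rightarrow> nat \<Rightarrow> nat set set" where
  "level n j = {A. A \<subseteq> {1..n} \<and> card A = j}"

lemma finite_level: "finite (level n j)"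
  by (rule finite_subset[of _ "Pow {1..n}"]) (auto simp: level_def)

lemma card_level: "card (level n j) = n choose j"
  unfolding level_def using n_subsets[of "{1..n}" j] by simp

lemma level_finite: "A \<in> level n j \<Longrightarrow> finite A"
  unfolding level_def by (auto intro: finite_subset)

lemma Suc_notin_level: "A \<in> level n j \<Longrightarrow> Suc n \<notin> A"
  unfolding level_def by auto

lemma level_disjoint: "i \<noteq> j \<Longrightarrow> level n i \<inter> level n j = {}"
  unfolding level_def by auto

lemma insert_in_level: "A \<in> level n j \<Longrightarrow> insert (Suc n) A \<in> level (Suc n) (Suc j)"
  using Suc_notin_level[of A n j] level_finite[of A n j] unfolding level_def by auto

lemma level_mono: "level n j \<subseteq> level (Suc n) j"
  unfolding level_def by auto

lemma level_Suc: "level (Suc n) (Suc k) = level n (Suc k) \<union> insert (Suc n) ` level n k"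
proof
  show "level (Suc n) (Suc k) \<subseteq> level n (Suc k) \<union> insert (Suc n) ` level n k"
  proof
    fix A assume A: "A \<in> level (Suc n) (Suc k)"
    show "A \<in> level n (Suc k) \<union> insert (Suc n) ` level n k"
    proof (cases "Suc n \<in> A")
      case True
      then have "A - {Suc n} \<in> level n k" using A level_finite[OF A] unfolding level_def by auto
      moreover have "A = insert (Suc n) (A - {Suc n})" using True by auto
      ultimately show ?thesis by blast
    next
      case False
      then show ?thesis using A unfolding level_def by (auto simp: subset_iff le_Suc_eq)
    qed
  qed
qed (use level_mono insert_in_level in auto)

text \<open>The chain starting in y is p (k + 1) y = y, p (k + 2) y, ..., p (n - k) y.\<close>
definition chain_cycle ::
  "nat \<Rightarrow> nat \<Rightarrow> nat set set \<Rightarrow> nat set set set \<Rightarrow> (nat \<Rightarrow> nat set \<Rightarrow> nat set) \<Rightarrow> bool" where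
  "chain_cycle n k Y F p \<longleftrightarrow> Y \<subseteq> level n (Suc k) \<and> card Y = n choose k \<and> ham_cycle (level n k \<union> Y) F \<and>
     (\<forall>e\<in>F. \<exists>a\<in>level n k. \<exists>b\<in>Y. a \<subseteq> b \<and> e = {a, b}) \<and>
     (\<forall>y\<in>Y. p (Suc k) y = y) \<and>
     (\<forall>j\<in>{Suc k..n - k}. inj_on (p j) Y \<and> p j ` Y \<subseteq> level n j) \<and>
     (\<forall>j\<in>{Suc k..<n - k}. \<forall>y\<in>Y. p j y \<subseteq> p (Suc j) y)"

text \<open>
  Makes the next \<open>spare_chain\<close> possible: when y is dropped from the cycle, its chain becomes free,
  and the edge from x to z that remains lies below the first two sets of this chain.
\<close>
definition tight_corner ::
  "nat \<Rightarrow> nat set set \<Rightarrow> nat set set set \<Rightarrow> (nat \<Rightarrow> nat set \<Rightarrow> nat set) \<Rightarrow> nat set \<Rightarrow> nat set \<Rightarrow> nat set \<Rightarrow> bool" where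
  "tight_corner k Y F p z x y \<longleftrightarrow>
     y \<in> Y \<and> z \<in> Y \<and> z \<noteq> y \<and> {x, y} \<in> F \<and> {x, z} \<in> F \<and> z \<subseteq> p (k + 2) y"

text \<open>\<open>r\<close> may end one level below the chains of \<open>p\<close>, because adding
  n + 1 to its sets raises it by one level. The edge from \<open>w\<close> to \<open>x\<close> is
  where the cycle will be opened: \<open>w\<close> is reconnected through \<open>r (Suc k)\<close>,
  and \<open>x\<close> and \<open>r (Suc k)\<close> both lie in \<open>r (k + 2)\<close>, so that
  they can be the two neighbours of one set of the other system.\<close>

definition spare_chain ::
  "nat \<Rightarrow> nat \<Rightarrow> nat set set \<Rightarrow> nat set set set \<Rightarrow> (nat \<Rightarrow> nat set \<Rightarrow> nat set) \<Rightarrow> (nat \<Rightarrow> nat set)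
     \<Rightarrow> nat set \<Rightarrow> nat set \<Rightarrow> bool" where
  "spare_chain n k Y F p r w x \<longleftrightarrow> w \<in> level n k \<and> x \<in> Y \<and> {w, x} \<in> F \<and> w \<subseteq> r (Suc k) \<and> x \<subseteq> r (k + 2) \<and>
     (\<forall>j\<in>{Suc k..n - Suc k}. r j \<in> level n j \<and> r j \<notin> p j ` Y) \<and>
     (\<forall>j\<in>{Suc k..<n - Suc k}. r j \<subseteq> r (Suc j))"

lemma chain_cycleD:
  assumes "chain_cycle n k Y F p"
  shows "Y \<subseteq> level n (Suc k)" "card Y = n choose k" "ham_cycle (level n k \<union> Y) F"
    and "e \<in> F \<Longrightarrow> \<exists>a\<in>level n k. \<exists>b\<in>Y. a \<subseteq> b \<and> e = {a, b}"
    and "y \<in> Y \<Longrightarrow> p (Suc k) y = y"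
    and "Suc k \<le> j \<Longrightarrow> j \<le> n - k \<Longrightarrow> inj_on (p j) Y"
    and "Suc k \<le> j \<Longrightarrow> j \<le> n - k \<Longrightarrow> y \<in> Y \<Longrightarrow> p j y \<in> level n j"
    and "Suc k \<le> j \<Longrightarrow> j < n - k \<Longrightarrow> y \<in> Y \<Longrightarrow> p j y \<subseteq> p (Suc j) y"
  using assms unfolding chain_cycle_def by (auto simp: image_subset_iff)

lemma chain_cycleI:
  assumes "Y \<subseteq> level n (Suc k)" "card Y = n choose k" "ham_cycle (level n k \<union> Y) F"
    and "\<And>e. e \<in> F \<Longrightarrow> \<exists>a\<in>level n k. \<exists>b\<in>Y. a \<subseteq> b \<and> e = {a, b}"
    and "\<And>y. y \<in> Y \<Longrightarrow> p (Suc k) y = y"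
    and "\<And>j. Suc k \<le> j \<Longrightarrow> j \<le> n - k \<Longrightarrow> inj_on (p j) Y"
    and "\<And>j y. Suc k \<le> j \<Longrightarrow> j \<le> n - k \<Longrightarrow> y \<in> Y \<Longrightarrow> p j y \<in> level n j"
    and "\<And>j y. Suc k \<le> j \<Longrightarrow> j < n - k \<Longrightarrow> y \<in> Y \<Longrightarrow> p j y \<subseteq> p (Suc j) y"
  shows "chain_cycle n k Y F p"
  unfolding chain_cycle_def by (intro conjI ballI) (simp_all add: assms image_subset_iff)

lemma chain_cycle_edge:
  assumes S: "chain_cycle n k Y F p" and "{x, y} \<in> F" "y \<in> Y"
  shows "x \<in> level n k \<and> x \<subseteq> y"
proof -
  obtain a b where ab: "a \<in> level n k" "b \<in> Y" "a \<subseteq> b" "{x, y} = {a, b}"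
    using chain_cycleD(4)[OF S assms(2)] by blast
  have "y \<in> level n (Suc k)" using chain_cycleD(1)[OF S] assms(3) by blast
  then have "y \<noteq> a" using ab(1) unfolding level_def by auto
  then show ?thesis using ab by (metis doubleton_eq_iff)
qed

section \<open>Permutations of the ground set\<close>

lemma permutes_image_level: "\<pi> permutes {1..n} \<Longrightarrow> A \<in> level n j \<Longrightarrow> \<pi> ` A \<in> level n j"
  unfolding level_def
  by (auto simp: permutes_in_image card_image[OF inj_on_subset[OF permutes_inj]] dest: permutes_in_image)

lemma permutes_level: "\<pi> permutes {1..n} \<Longrightarrow> (`) \<pi> ` level n j = level n j"
proof
  assume \<pi>: "\<pi> permutes {1..n}"
  show "(`) \<pi> ` level n j \<subseteq> level n j" using permutes_image_level[OF \<pi>] by auto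
  show "level n j \<subseteq> (`) \<pi> ` level n j"
  proof
    fix A assume "A \<in> level n j"
    then have "inv \<pi> ` A \<in> level n j" using permutes_image_level permutes_inv[OF \<pi>] by blast
    moreover have "A = \<pi> ` inv \<pi> ` A" using permutes_surj[OF \<pi>] by (simp add: image_f_inv_f)
    ultimately show "A \<in> (`) \<pi> ` level n j" by blast
  qed
qed

lemma chain_cycle_permute:
  assumes \<pi>: "\<pi> permutes {1..n}" and S: "chain_cycle n k Y F p"
  shows "chain_cycle n k ((`) \<pi> ` Y) ((`) ((`) \<pi>) ` F) (\<lambda>j A. \<pi> ` p j (inv \<pi> ` A))"
proof -
  have inj: "inj \<pi>" using permutes_inj[OF \<pi>] .
  have injim: "inj ((`) \<pi>)" by (rule injI) (simp add: inj_image_eq_iff[OF inj])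
  have inv: "inv \<pi> ` \<pi> ` A = A" for A using inj by (simp add: image_inv_f_f)
  have Y: "Y \<subseteq> level n (Suc k)" "card Y = n choose k" "ham_cycle (level n k \<union> Y) F"
    using S unfolding chain_cycle_def by auto
  show ?thesis
  proof (rule chain_cycleI)
    show "(`) \<pi> ` Y \<subseteq> level n (Suc k)" using Y(1) permutes_image_level[OF \<pi>] by blast
    show "card ((`) \<pi> ` Y) = n choose k" using Y(2) injim by (simp add: card_image inj_on_subset)
    show "ham_cycle (level n k \<union> (`) \<pi> ` Y) ((`) ((`) \<pi>) ` F)"
    using ham_cycle_image[OF Y(3), of "(`) \<pi>"] injim permutes_level[OF \<pi>] by (simp add: image_Un inj_on_subset)
    show "\<exists>a\<in>level n k. \<exists>b\<in>(`) \<pi> ` Y. a \<subseteq> b \<and> e = {a, b}" if e: "e \<in> (`) ((`) \<pi>) ` F" for e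
    proof -
      obtain f where f: "f \<in> F" "e = (`) \<pi> ` f" using e by blast
      obtain a b where ab: "a \<in> level n k" "b \<in> Y" "a \<subseteq> b" "f = {a, b}"
        using chain_cycleD(4)[OF S f(1)] by blast
      then have "\<pi> ` a \<in> level n k" "\<pi> ` b \<in> (`) \<pi> ` Y" "\<pi> ` a \<subseteq> \<pi> ` b" "e = {\<pi> ` a, \<pi> ` b}"
        using f(2) permutes_image_level[OF \<pi>] by auto
      then show ?thesis by blast
    qed
    show "\<pi> ` p (Suc k) (inv \<pi> ` y) = y" if "y \<in> (`) \<pi> ` Y" for y
      using that chain_cycleD(5)[OF S] by (auto simp: inv)
    show "inj_on (\<lambda>A. \<pi> ` p j (inv \<pi> ` A)) ((`) \<pi> ` Y)" if "Suc k \<le> j" "j \<le> n - k" for j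
      using chain_cycleD(6)[OF S that] unfolding inj_on_def by (simp add: inv inj_image_eq_iff inj)
    show "\<pi> ` p j (inv \<pi> ` y) \<in> level n j" if "Suc k \<le> j" "j \<le> n - k" "y \<in> (`) \<pi> ` Y" for j y
      using that(3) chain_cycleD(7)[OF S that(1,2)] permutes_image_level[OF \<pi>] by (auto simp: inv)
    show "\<pi> ` p j (inv \<pi> ` y) \<subseteq> \<pi> ` p (Suc j) (inv \<pi> ` y)"
      if "Suc k \<le> j" "j < n - k" "y \<in> (`) \<pi> ` Y" for j y
      using that(3) chain_cycleD(8)[OF S that(1,2)] by (elim imageE) (simp add: inv image_mono)
  qed
qed

lemma tight_corner_permute:
  assumes \<pi>: "\<pi> permutes {1..n}" and "tight_corner k Y F p z x y"
  shows "tight_corner k ((`) \<pi> ` Y) ((`) ((`) \<pi>) ` F) (\<lambda>j A. \<pi> ` p j (inv \<pi> ` A)) (\<pi> ` z) (\<pi> ` x) (\<pi> ` y)"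
proof -
  have inj: "inj \<pi>" using permutes_inj[OF \<pi>] .
  have e: "{\<pi> ` a, \<pi> ` b} \<in> (`) ((`) \<pi>) ` F" if "{a, b} \<in> F" for a b
    using imageI[OF that, of "(`) ((`) \<pi>)"] by simp
  show ?thesis using assms(2) e unfolding tight_corner_def
    by (auto simp: image_inv_f_f[OF inj] inj_image_eq_iff[OF inj] intro!: image_mono)
qed

text \<open>A permutation that is right on the smaller sets is corrected by a transposition, which
  exchanges the image of the new element with the desired one. Neither of the two lies in an earlier
  \<open>t j\<close>, so those sets stay fixed.\<close>

lemma flag_permutes:
  fixes s t :: "nat \<Rightarrow> nat set"
  assumes "a \<le> b" "\<And>j. j \<in> {a..b} \<Longrightarrow> s j \<in> level n j \<and> t j \<in> level n j"
    and "\<And>j. j \<in> {a..<b} \<Longrightarrow> s j \<subseteq> s (Suc j) \<and> t j \<subseteq> t (Suc j)"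
  shows "\<exists>\<pi>. \<pi> permutes {1..n} \<and> (\<forall>j\<in>{a..b}. \<pi> ` s j = t j)"
  using assms
proof (induction b rule: dec_induct)
  case base
  have st: "s a \<subseteq> {1..n}" "t a \<subseteq> {1..n}" "card (s a) = card (t a)" using base unfolding level_def by auto
  then have fin: "finite (s a)" "finite (t a)" by (auto intro: finite_subset)
  obtain f where f: "bij_betw f (s a) (t a)" using finite_same_card_bij[OF fin st(3)] by blast
  have "card ({1..n} - s a) = card ({1..n} - t a)" using st fin by (simp add: card_Diff_subset)
  then obtain g where g: "bij_betw g ({1..n} - s a) ({1..n} - t a)"
    using finite_same_card_bij[of "{1..n} - s a" "{1..n} - t a"] by auto
  define h where "h m = (if m \<in> s a then f m else if m \<in> {1..n} then g m else m)" for m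
  have "bij_betw h (s a) (t a)" using f by (rule bij_betw_cong[THEN iffD1, rotated]) (simp add: h_def)
  moreover have "bij_betw h ({1..n} - s a) ({1..n} - t a)"
    using g by (rule bij_betw_cong[THEN iffD1, rotated]) (simp add: h_def)
  ultimately have "bij_betw h (s a \<union> ({1..n} - s a)) (t a \<union> ({1..n} - t a))"
    by (rule bij_betw_combine) auto
  then have "bij_betw h {1..n} {1..n}" using st by (simp add: Un_absorb1)
  then have "h permutes {1..n}" by (rule bij_imp_permutes) (use st in \<open>auto simp: h_def\<close>)
  moreover have "h ` s a = t a" using \<open>bij_betw h (s a) (t a)\<close> by (simp add: bij_betw_def)
  ultimately show ?case by auto
next
  case (step b)
  obtain \<pi> where \<pi>: "\<pi> permutes {1..n}" "\<And>j. j \<in> {a..b} \<Longrightarrow> \<pi> ` s j = t j"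
    using step.IH step.prems by fastforce
  have lev: "s b \<in> level n b" "t b \<in> level n b" "s (Suc b) \<in> level n (Suc b)" "t (Suc b) \<in> level n (Suc b)"
    and sub: "s b \<subseteq> s (Suc b)" "t b \<subseteq> t (Suc b)"
    using step.prems step.hyps by auto
  have extend: "\<exists>c \<in> {1..n}. c \<notin> A \<and> B = insert c A" if "A \<in> level n b" "B \<in> level n (Suc b)" "A \<subseteq> B" for A B
  proof -
    have "card (B - A) = 1" using that level_finite[OF that(1)] by (simp add: card_Diff_subset level_def)
    then obtain c where "B - A = {c}" by (auto simp: card_1_singleton_iff)
    then show ?thesis using that unfolding level_def by (intro bexI[of _ c]) auto
  qed
  obtain c where c: "c \<in> {1..n}" "c \<notin> s b" "s (Suc b) = insert c (s b)" using extend lev sub by blast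
  obtain d where d: "d \<in> {1..n}" "d \<notin> t b" "t (Suc b) = insert d (t b)" using extend lev sub by blast
  let ?\<tau> = "Transposition.transpose (\<pi> c) d"
  have "\<pi> c \<in> {1..n}" using permutes_in_image[OF \<pi>(1), of c] c(1) by blast
  moreover have "\<pi> c \<notin> t b"
    using c(2) \<pi>(2)[of b] step.hyps inj_image_mem_iff[OF permutes_inj[OF \<pi>(1)], of c "s b"] by simp
  ultimately have \<pi>c: "\<pi> c \<in> {1..n}" "\<pi> c \<notin> t b" by blast+
  have fix_t: "?\<tau> ` A = A" if "A \<subseteq> t b" for A
  proof -
    have "?\<tau> m = m" if "m \<in> A" for m using that \<open>A \<subseteq> t b\<close> \<pi>c(2) d(2) by (intro transpose_apply_other) auto
    then show ?thesis by auto
  qed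
  have tsub: "t j \<subseteq> t b" if "j \<in> {a..b}" for j
  proof -
    have "j \<le> b" "a \<le> j" using that by auto
    then show ?thesis
    proof (induction j rule: inc_induct)
      case (step j)
      then show ?case using step.prems \<open>\<And>j. j \<in> {a..<Suc b} \<Longrightarrow> s j \<subseteq> s (Suc j) \<and> t j \<subseteq> t (Suc j)\<close>[of j] by auto
    qed simp
  qed
  have "(?\<tau> \<circ> \<pi>) permutes {1..n}"
    by (rule permutes_compose[OF \<pi>(1)]) (rule permutes_swap_id[OF \<pi>c(1) d(1)])
  moreover have "(?\<tau> \<circ> \<pi>) ` s j = t j" if "j \<in> {a..Suc b}" for j
  proof (cases "j = Suc b")
    case True
    have "\<pi> ` s j = insert (\<pi> c) (t b)" unfolding True c(3) using \<pi>(2)[of b] step.hyps by simp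
    then have "(?\<tau> \<circ> \<pi>) ` s j = insert (?\<tau> (\<pi> c)) (?\<tau> ` t b)"
      by (simp only: image_comp[symmetric] image_insert)
    then show ?thesis using fix_t[of "t b"] d(3) True by simp
  next
    case False
    then have j: "j \<in> {a..b}" using that by auto
    then show ?thesis using \<pi>(2)[OF j] fix_t[OF tsub[OF j]] by (simp only: image_comp[symmetric])
  qed
  ultimately show ?case by blast
qed

section \<open>From n to n + 1\<close>

lemma inj_on_insert_fresh: "inj_on (insert a) {A. a \<notin> A}"
  by (rule inj_onI) (metis insert_ident mem_Collect_eq)

text \<open>
  The system for (n, k + 1) loses y, and insert (n + 1) (r (k + 1)) replaces it. The new set takes the chain r
  with n + 1 added; this is free, and its top is the set to which the chain of y would have been extended.
  The other chains of the first system gain one level: along a chain of the second system if they end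
  on one, and by adding n + 1 otherwise.
\<close>
lemma chain_cycle_glue:
  assumes n: "2 * k + 3 \<le> n"
    and S0: "chain_cycle n (Suc k) Y0 F0 p0" and S1: "chain_cycle n k Y1 F1 p1"
    and R: "spare_chain n k Y1 F1 p1 r w x"
    and y: "y \<in> Y0" and e: "{x, y} \<in> F0" "{r (Suc k), y} \<in> F0"
    and align: "\<And>j. k + 2 \<le> j \<Longrightarrow> j < n - k \<Longrightarrow> p0 j y = r j"
  shows "\<exists>Y F p. chain_cycle (Suc n) (Suc k) Y F p \<and>
    (\<forall>z1 x1 y1. tight_corner k Y1 F1 p1 z1 x1 y1 \<and> {w, x} \<noteq> {x1, y1} \<and> {w, x} \<noteq> {x1, z1} \<longrightarrow>
       tight_corner (Suc k) Y F p (insert (Suc n) z1) (insert (Suc n) x1) (insert (Suc n) y1)) \<and>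
    (\<forall>z. tight_corner (Suc k) Y0 F0 p0 z x y \<longrightarrow> spare_chain (Suc n) (Suc k) Y F p (\<lambda>j. p0 j y) x z)"
proof -
  let ?i = "insert (Suc n)"
  define x' where "x' = r (Suc k)"
  note Y0 = chain_cycleD(1)[OF S0] and Y1 = chain_cycleD(1)[OF S1]
  have Rw: "w \<in> level n k" "x \<in> Y1" "{w, x} \<in> F1" "w \<subseteq> x'" "x \<subseteq> r (k + 2)"
    and Rlev: "\<And>j. Suc k \<le> j \<Longrightarrow> j < n - k \<Longrightarrow> r j \<in> level n j"
    and Rnot: "\<And>j A. Suc k \<le> j \<Longrightarrow> j < n - k \<Longrightarrow> A \<in> Y1 \<Longrightarrow> r j \<noteq> p1 j A"
    and Rmono: "\<And>j. Suc k \<le> j \<Longrightarrow> Suc j < n - k \<Longrightarrow> r j \<subseteq> r (Suc j)"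
    using R unfolding spare_chain_def x'_def by force+
  have "Suc k < n - k" using n by linarith
  then have x': "x' \<in> level n (Suc k)" "x' \<notin> Y1"
    using Rlev[of "Suc k"] Rnot[of "Suc k" x'] chain_cycleD(5)[OF S1, of x'] unfolding x'_def by auto
  have neq: "x \<noteq> x'" using x'(2) Rw(2) by auto
  have xl: "x \<in> level n (Suc k)" using Rw(2) Y1 by blast

  \<comment> \<open>The second system enlarged by \<open>x'\<close> with chain \<open>r\<close>.
    From here on its chains are used only below level \<open>n - k\<close>, where \<open>r\<close>
    exists too.\<close>
  define Y1' where "Y1' = insert x' Y1"
  define q where "q j A = (if A = x' then r j else p1 j A)" for j A
  have Y1': "Y1' \<subseteq> level n (Suc k)" "finite Y1'" "card Y1' = Suc (n choose k)"
    using Y1 x' chain_cycleD(2)[OF S1] finite_subset[OF Y1 finite_level] unfolding Y1'_def by auto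
  have q_lev: "q j A \<in> level n j" if "Suc k \<le> j" "j < n - k" "A \<in> Y1'" for j A
    using that Rlev chain_cycleD(7)[OF S1, of j A] unfolding q_def Y1'_def by auto
  have q_inj: "inj_on (q j) Y1'" if "Suc k \<le> j" "j < n - k" for j
  proof (rule inj_onI)
    fix A B assume AB: "A \<in> Y1'" "B \<in> Y1'" "q j A = q j B"
    show "A = B"
    proof (cases "A = x' \<or> B = x'")
      case True
      then show ?thesis using AB Rnot[OF that, of A] Rnot[OF that, of B] unfolding q_def Y1'_def by (auto split: if_splits)
    next
      case False
      then show ?thesis using AB inj_onD[OF chain_cycleD(6)[OF S1 that(1)], of A B] that(2)
        unfolding q_def Y1'_def by auto
    qed
  qed
  have q_id: "q (Suc k) A = A" if "A \<in> Y1'" for A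
    using that chain_cycleD(5)[OF S1] unfolding q_def Y1'_def x'_def by auto
  have q_mono: "q j A \<subseteq> q (Suc j) A" if "Suc k \<le> j" "Suc j < n - k" "A \<in> Y1'" for j A
    using that Rmono chain_cycleD(8)[OF S1, of j A] unfolding q_def Y1'_def by auto

  \<comment> \<open>Level \<open>m\<close> is the top of the chains of the first system and the last
    but one level of those of the second.\<close>
  define m where "m = n - k - 1"
  have m: "k + 2 \<le> m" "n - k = Suc m" "n - Suc k = m" "Suc n - Suc k = Suc m" using n unfolding m_def by auto
  \<comment> \<open>With n + 1 added, the chains of the second system no longer use their old tops
    \<open>p1 (Suc m) B\<close>. These lack n + 1 and are free; they are taken exactly where adding
    n + 1 would hit a lifted chain of \<open>Y1\<close>.\<close>
  define lift where "lift B = (if B \<in> p1 m ` Y1 then p1 (Suc m) (inv_into Y1 (p1 m) B) else ?i B)" for B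
  define p where "p j A = (if Suc n \<in> A then ?i (q (j - 1) (A - {Suc n})) else if j \<le> m then p0 j A else lift (p0 m A))" for j A
  define C where "C = Y0 - {y}"
  define Y where "Y = C \<union> ?i ` Y1'"
  have C: "A \<in> Y0" "A \<noteq> y" "Suc n \<notin> A" if "A \<in> C" for A
    using that Y0 Suc_notin_level unfolding C_def by auto
  have pC: "p j A = p0 j A" if "A \<in> C" "j \<le> m" for A j using that C(3) unfolding p_def by simp
  have pCm: "p (Suc m) A = lift (p0 m A)" if "A \<in> C" for A using that C(3) unfolding p_def by simp
  have pi: "p (Suc j) (?i A) = ?i (q j A)" if "A \<in> Y1'" for A j
  proof -
    have "Suc n \<notin> A" using that Y1'(1) Suc_notin_level by blast
    then have "?i A - {Suc n} = A" by simp
    then show ?thesis unfolding p_def by simp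
  qed
  have p0m: "p0 m A \<in> level n m" if "A \<in> Y0" for A using chain_cycleD(7)[OF S0 _ _ that, of m] m by simp
  have lift_in: "lift B \<in> level n (Suc m) \<and> B \<subseteq> lift B \<and> (\<exists>A\<in>Y1. B = p1 m A \<and> lift B = p1 (Suc m) A)"
    if "B \<in> p1 m ` Y1" for B
  proof -
    have A: "inv_into Y1 (p1 m) B \<in> Y1" "p1 m (inv_into Y1 (p1 m) B) = B"
      by (rule inv_into_into[OF that], rule f_inv_into_f[OF that])
    then show ?thesis using that chain_cycleD(7)[OF S1 _ _ A(1), of "Suc m"] chain_cycleD(8)[OF S1 _ _ A(1), of m] m
      unfolding lift_def by auto
  qed
  have lift_out: "lift B = ?i B" if "B \<notin> p1 m ` Y1" for B using that unfolding lift_def by simp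
  have lift_sub: "B \<subseteq> lift B" for B using lift_in[of B] lift_out[of B] by blast
  have lift_lev: "lift B \<in> level (Suc n) (Suc m)" if "B \<in> level n m" for B
    using lift_in[of B] lift_out[of B] insert_in_level[OF that] level_mono by (metis subsetD)
  have lift_inj: "A = B" if "A \<in> level n m" "B \<in> level n m" "lift A = lift B" for A B
  proof -
    have nin: "Suc n \<notin> lift B" if "B \<in> p1 m ` Y1" for B using lift_in[OF that] Suc_notin_level by blast
    consider "A \<in> p1 m ` Y1" "B \<in> p1 m ` Y1" | "A \<notin> p1 m ` Y1" "B \<notin> p1 m ` Y1"
      using nin lift_out \<open>lift A = lift B\<close> by (metis insertI1)
    then show ?thesis
    proof cases
      case 1
      obtain A' B' where "A' \<in> Y1" "B' \<in> Y1" "A = p1 m A'" "B = p1 m B'" "p1 (Suc m) A' = p1 (Suc m) B'"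
        using lift_in[OF 1(1)] lift_in[OF 1(2)] \<open>lift A = lift B\<close> by metis
      moreover have "inj_on (p1 (Suc m)) Y1" using chain_cycleD(6)[OF S1, of "Suc m"] m by simp
      ultimately show ?thesis by (metis inj_onD)
    next
      case 2
      then have "?i A = ?i B" using lift_out \<open>lift A = lift B\<close> by simp
      then show ?thesis using that(1,2) Suc_notin_level by (metis insert_ident)
    qed
  qed

  \<comment> \<open>In cyclic order: from \<open>x'\<close> through the first cycle without
    \<open>y\<close> to \<open>x\<close>, then to \<open>?i x\<close>, through the second cycle
    opened between \<open>x\<close> and \<open>w\<close> to \<open>?i w\<close>, then to
    \<open>?i x'\<close> and back to \<open>x'\<close>.\<close>
  define F where "F = insert {?i x', x'} (insert {?i w, ?i x'}
     (insert {x, ?i x} (F0 - {{x, y}, {y, x'}} \<union> (`) ?i ` (F1 - {{x, w}})) \<union> {}))"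
  have cyc: "ham_cycle (level (Suc n) (Suc k) \<union> Y) F"
  proof -
    let ?V0 = "level n (Suc k) \<union> Y0" and ?V1 = "level n k \<union> Y1"
    have "Y0 \<subseteq> level n (Suc (Suc k))" by (rule Y0)
    then have nN0: "Suc n \<notin> A" if "A \<in> ?V0" for A using that Suc_notin_level by blast
    have nN1: "Suc n \<notin> A" if "A \<in> ?V1" for A using that Y1 Suc_notin_level by blast
    have P0: "ham_path (?V0 - {y}) (F0 - {{x, y}, {y, x'}}) x' x"
      using e neq by (intro ham_cycle_drop chain_cycleD(3)[OF S0]) (auto simp: x'_def insert_commute)
    have "ham_path ?V1 (F1 - {{x, w}}) x w"
      using Rw(3) by (intro ham_cycle_open chain_cycleD(3)[OF S1]) (simp add: insert_commute)
    then have P1: "ham_path (?i ` ?V1) ((`) ?i ` (F1 - {{x, w}})) (?i x) (?i w)"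
      by (rule ham_path_image) (use nN1 in \<open>auto intro: inj_on_subset[OF inj_on_insert_fresh]\<close>)
    have "(?V0 - {y}) \<inter> ?i ` ?V1 = {}" using nN0 by blast
    from ham_path_join[OF P0 P1 this]
    have P01: "ham_path ((?V0 - {y}) \<union> ?i ` ?V1) (insert {x, ?i x} (F0 - {{x, y}, {y, x'}} \<union> (`) ?i ` (F1 - {{x, w}}))) x' (?i w)" .
    have "x' \<notin> ?V1" using x' level_disjoint[of k "Suc k" n] by auto
    have "?i x' \<notin> ?i ` ?V1"
    proof
      assume "?i x' \<in> ?i ` ?V1"
      then obtain A where A: "A \<in> ?V1" "?i x' = ?i A" by blast
      then have "x' = A" using insert_ident[OF Suc_notin_level[OF x'(1)] nN1[OF A(1)]] by simp
      then show False using A(1) \<open>x' \<notin> ?V1\<close> by simp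
    qed
    then have dis: "((?V0 - {y}) \<union> ?i ` ?V1) \<inter> {?i x'} = {}" using nN0 by blast
    have P: "ham_path (((?V0 - {y}) \<union> ?i ` ?V1) \<union> {?i x'})
      (insert {?i w, ?i x'} (insert {x, ?i x} (F0 - {{x, y}, {y, x'}} \<union> (`) ?i ` (F1 - {{x, w}})) \<union> {})) x' (?i x')"
      by (rule ham_path_join[OF P01 ham_path_singleton dis])
    have "card (?i ` ?V1) = card ?V1"
      using nN1 by (intro card_image inj_on_subset[OF inj_on_insert_fresh]) auto
    also have "3 \<le> \<dots>" using ham_cycle_card[OF chain_cycleD(3)[OF S1]] by simp
    finally have c3: "3 \<le> card (?i ` ?V1)" .
    have "finite (((?V0 - {y}) \<union> ?i ` ?V1) \<union> {?i x'})" using P unfolding ham_path_def by (metis finite_set)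
    then have "card (?i ` ?V1) \<le> card (((?V0 - {y}) \<union> ?i ` ?V1) \<union> {?i x'})" by (intro card_mono) auto
    then have c: "3 \<le> card (((?V0 - {y}) \<union> ?i ` ?V1) \<union> {?i x'})" using c3 by simp
    have "y \<notin> level n (Suc k)" using y Y0 level_disjoint[of "Suc k" "Suc (Suc k)" n] by auto
    then have "((?V0 - {y}) \<union> ?i ` ?V1) \<union> {?i x'} = level (Suc n) (Suc k) \<union> Y"
      unfolding level_Suc Y_def C_def Y1'_def by auto
    then show ?thesis using ham_path_close[OF P c] unfolding F_def by simp
  qed

  have "chain_cycle (Suc n) (Suc k) Y F p"
  proof (rule chain_cycleI)
    show "Y \<subseteq> level (Suc n) (Suc (Suc k))"
      using Y0 Y1' level_mono insert_in_level unfolding Y_def C_def by blast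
    have finY0: "finite Y0" using Y0 finite_level finite_subset by blast
    have "card (?i ` Y1') = Suc (n choose k)"
    proof -
      have "Y1' \<subseteq> {A. Suc n \<notin> A}" using Y1'(1) Suc_notin_level by blast
      from card_image[OF inj_on_subset[OF inj_on_insert_fresh this]] show ?thesis unfolding Y1'(3) .
    qed
    moreover have "card C = (n choose Suc k) - 1"
      using y finY0 chain_cycleD(2)[OF S0] unfolding C_def by simp
    moreover have "card Y0 > 0" using y finY0 card_gt_0_iff by blast
    moreover have "C \<inter> ?i ` Y1' = {}" using C(3) by blast
    ultimately show "card Y = Suc n choose Suc k"
      using chain_cycleD(2)[OF S0] finY0 Y1'(2) unfolding Y_def C_def by (subst card_Un_disjoint) auto
    show "ham_cycle (level (Suc n) (Suc k) \<union> Y) F" by (rule cyc)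
    show "\<exists>a\<in>level (Suc n) (Suc k). \<exists>b\<in>Y. a \<subseteq> b \<and> f = {a, b}" if f: "f \<in> F" for f
    proof -
      have sub: "level n (Suc k) \<subseteq> level (Suc n) (Suc k)" "?i ` level n k \<subseteq> level (Suc n) (Suc k)"
        using level_mono insert_in_level by auto
      have "?i x \<in> Y" "?i x' \<in> Y" using Rw(2) unfolding Y_def Y1'_def by auto
      have "x \<in> level (Suc n) (Suc k)" "x' \<in> level (Suc n) (Suc k)" "?i w \<in> level (Suc n) (Suc k)"
        using sub xl x'(1) Rw(1) by auto
      have edge: ?thesis if "a \<in> level (Suc n) (Suc k)" "b \<in> Y" "a \<subseteq> b" "f = {a, b}" for a b
        using that by blast
      have "f = {?i x', x'} \<or> f = {?i w, ?i x'} \<or> f = {x, ?i x} \<or> f \<in> F0 - {{x, y}, {y, x'}} \<or>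
          f \<in> (`) ?i ` (F1 - {{x, w}})"
        using f unfolding F_def by (simp only: insert_iff Un_iff empty_iff simp_thms disj_ac)
      then show ?thesis
      proof (elim disjE)
        assume "f = {?i x', x'}"
        then have "f = {x', ?i x'}" by (simp add: insert_commute)
        then show ?thesis
          by (rule edge[OF \<open>x' \<in> level (Suc n) (Suc k)\<close> \<open>?i x' \<in> Y\<close> subset_insertI])
      next
        assume "f = {?i w, ?i x'}"
        then show ?thesis
          by (rule edge[OF \<open>?i w \<in> level (Suc n) (Suc k)\<close> \<open>?i x' \<in> Y\<close> insert_mono[OF Rw(4)]])
      next
        assume "f = {x, ?i x}"
        then show ?thesis
          by (rule edge[OF \<open>x \<in> level (Suc n) (Suc k)\<close> \<open>?i x \<in> Y\<close> subset_insertI])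
      next
        assume 4: "f \<in> F0 - {{x, y}, {y, x'}}"
        then obtain a b where ab: "a \<in> level n (Suc k)" "b \<in> Y0" "a \<subseteq> b" "f = {a, b}"
          using chain_cycleD(4)[OF S0, of f] by blast
        \<comment> \<open>Both edges at \<open>y\<close> have been removed; this is read off from
          the path that remains, whose edges avoid \<open>y\<close>.\<close>
        have "b \<noteq> y"
        proof
          assume "b = y"
          have "ham_path (level n (Suc k) \<union> Y0 - {y}) (F0 - {{x, y}, {y, x'}}) x' x"
            using e neq by (intro ham_cycle_drop chain_cycleD(3)[OF S0]) (auto simp: x'_def insert_commute)
          then have "f \<subseteq> level n (Suc k) \<union> Y0 - {y}" using 4 by (rule ham_path_edge_subset)
          then show False using ab(4) \<open>b = y\<close> by blast
        qed
        then have "b \<in> Y" using ab(2) unfolding Y_def C_def by blast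
        then show ?thesis using edge[of a b] ab sub(1) by blast
      next
        assume "f \<in> (`) ?i ` (F1 - {{x, w}})"
        then obtain g where g: "g \<in> F1" "f = ?i ` g" by blast
        obtain a b where ab: "a \<in> level n k" "b \<in> Y1" "a \<subseteq> b" "g = {a, b}"
          using chain_cycleD(4)[OF S1 g(1)] by blast
        have "?i a \<in> level (Suc n) (Suc k)" "?i b \<in> Y" "?i a \<subseteq> ?i b" "f = {?i a, ?i b}"
          using g(2) ab sub(2) unfolding Y_def Y1'_def by auto
        then show ?thesis by (rule edge)
      qed
    qed
    show "p (Suc (Suc k)) A = A" if "A \<in> Y" for A
      using that pC[of A "Suc (Suc k)"] C(1) chain_cycleD(5)[OF S0] m(1) pi q_id unfolding Y_def by auto
    show "p j A \<in> level (Suc n) j" if jA: "Suc (Suc k) \<le> j" "j \<le> Suc n - Suc k" "A \<in> Y" for j A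
    proof (cases "A \<in> C")
      case True
      show ?thesis
      proof (cases "j \<le> m")
        case j: True
        then have "p0 j A \<in> level n j" using chain_cycleD(7)[OF S0 jA(1) _ C(1)[OF True]] m by simp
        then show ?thesis using pC[OF True j] level_mono by auto
      next
        case False
        then have "j = Suc m" using jA(2) m by simp
        then show ?thesis using pCm[OF True] lift_lev[OF p0m[OF C(1)[OF True]]] by simp
      qed
    next
      case False
      then obtain B where B: "A = ?i B" "B \<in> Y1'" using jA(3) unfolding Y_def by blast
      obtain j' where j': "j = Suc j'" using jA(1) by (cases j) auto
      show ?thesis using q_lev[of j' B] pi[OF B(2), of j'] jA(1,2) B j' m by (auto intro: insert_in_level)
    qed
    show "p j A \<subseteq> p (Suc j) A" if jA: "Suc (Suc k) \<le> j" "j < Suc n - Suc k" "A \<in> Y" for j A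
    proof (cases "A \<in> C")
      case True
      show ?thesis
      proof (cases "j < m")
        case j: True
        then show ?thesis using chain_cycleD(8)[OF S0 jA(1) _ C(1)[OF True]] m pC[OF True] by simp
      next
        case False
        then have "j = m" using jA(2) m by simp
        then show ?thesis using pCm[OF True] pC[OF True] lift_sub by simp
      qed
    next
      case False
      then obtain B where B: "A = ?i B" "B \<in> Y1'" using jA(3) unfolding Y_def by blast
      obtain j' where j': "j = Suc j'" using jA(1) by (cases j) auto
      have "q j' B \<subseteq> q (Suc j') B" using q_mono[of j' B] jA(1,2) B j' m by simp
      then show ?thesis unfolding B(1) j' pi[OF B(2)] by blast
    qed
    show "inj_on (p j) Y" if j: "Suc (Suc k) \<le> j" "j \<le> Suc n - Suc k" for j
    proof -
      obtain j' where j': "j = Suc j'" using j(1) by (cases j) auto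
      have jb: "Suc k \<le> j'" "j' < n - k" using j j' m by auto
      have injC: "inj_on (p j) C"
      proof (rule inj_onI)
        fix A B assume AB: "A \<in> C" "B \<in> C" "p j A = p j B"
        have inj0: "inj_on (p0 i) Y0" if "Suc (Suc k) \<le> i" "i \<le> m" for i
          using chain_cycleD(6)[OF S0 that(1)] that(2) m by simp
        show "A = B"
        proof (cases "j \<le> m")
          case True
          then have "p0 j A = p0 j B" using AB pC by simp
          then show ?thesis using inj_onD[OF inj0[OF j(1) True]] AB C(1) by blast
        next
          case False
          then have "j = Suc m" using j(2) m by simp
          then have "lift (p0 m A) = lift (p0 m B)" using AB pCm by simp
          then have "p0 m A = p0 m B" using lift_inj p0m AB C(1) by blast
          then show ?thesis using inj_onD[OF inj0[of m]] AB C(1) m by simp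
        qed
      qed
      have injI: "inj_on (p j) (?i ` Y1')"
      proof (rule inj_onI)
        fix A B assume "A \<in> ?i ` Y1'" "B \<in> ?i ` Y1'" and eq: "p j A = p j B"
        then obtain A' B' where AB: "A = ?i A'" "A' \<in> Y1'" "B = ?i B'" "B' \<in> Y1'" by blast
        then have "?i (q j' A') = ?i (q j' B')" using eq pi j' by simp
        then have "q j' A' = q j' B'" using q_lev[OF jb AB(2)] q_lev[OF jb AB(4)] Suc_notin_level by (metis insert_ident)
        then show "A = B" using inj_onD[OF q_inj[OF jb]] AB by blast
      qed
      have "p j A \<noteq> p j (?i B)" if A: "A \<in> C" and B: "B \<in> Y1'" for A B
      proof (cases "j \<le> m")
        case True
        then have "p0 j A \<in> level n j" using chain_cycleD(7)[OF S0 j(1) _ C(1)[OF A]] m by simp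
        then have "Suc n \<notin> p j A" using pC[OF A True] Suc_notin_level by simp
        then show ?thesis using pi[OF B, of j'] j' by auto
      next
        case False
        then have jm: "j = Suc m" "j' = m" using j(2) m j' by auto
        show ?thesis
        proof
          assume "p j A = p j (?i B)"
          then have eq: "lift (p0 m A) = ?i (q m B)" using pCm[OF A] pi[OF B, of m] jm by simp
          \<comment> \<open>The other branch of \<open>lift\<close> would give a set without n +
            1.\<close>
          then have out: "p0 m A \<notin> p1 m ` Y1" using lift_in Suc_notin_level by (metis insertI1)
          then have "?i (p0 m A) = ?i (q m B)" using eq lift_out by simp
          then have pq: "p0 m A = q m B"
            using p0m[OF C(1)[OF A]] q_lev[OF _ _ B, of m] m Suc_notin_level by (metis insert_ident jb jm(2))
          show False
          proof (cases "B = x'")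
            case True
            \<comment> \<open>Here the alignment is used: only the chain of \<open>y\<close> ends in
              \<open>r m\<close>, and \<open>y\<close> has been deleted.\<close>
            then have "p0 m A = p0 m y" using pq align[of m] m unfolding q_def by simp
            moreover have "inj_on (p0 m) Y0" using chain_cycleD(6)[OF S0, of m] m by simp
            ultimately show False using y C(1,2)[OF A] by (metis inj_onD)
          next
            case False
            then show False using pq out B unfolding q_def Y1'_def by auto
          qed
        qed
      qed
      then have "p j ` C \<inter> p j ` (?i ` Y1') = {}" by blast
      moreover have "C - ?i ` Y1' = C" "?i ` Y1' - C = ?i ` Y1'" using C(3) by blast+
      ultimately show ?thesis unfolding Y_def using injC injI by (simp add: inj_on_Un)
    qed
  qed
  moreover have "tight_corner (Suc k) Y F p (?i z1) (?i x1) (?i y1)"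
    if T: "tight_corner k Y1 F1 p1 z1 x1 y1" and "{w, x} \<noteq> {x1, y1}" "{w, x} \<noteq> {x1, z1}" for z1 x1 y1
  proof -
    have T': "y1 \<in> Y1" "z1 \<in> Y1" "z1 \<noteq> y1" "{x1, y1} \<in> F1" "{x1, z1} \<in> F1" "z1 \<subseteq> p1 (k + 2) y1"
      using T unfolding tight_corner_def by auto
    have inF: "{?i x1, ?i a} \<in> F" if "{x1, a} \<in> F1" "{w, x} \<noteq> {x1, a}" for a
    proof -
      have "{x1, a} \<in> F1 - {{x, w}}" using that by (simp add: insert_commute)
      then have "?i ` {x1, a} \<in> (`) ?i ` (F1 - {{x, w}})" by (rule imageI)
      then show ?thesis unfolding F_def by simp
    qed
    have "?i z1 \<noteq> ?i y1" using T'(1-3) Y1 Suc_notin_level by (metis insert_ident subsetD)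
    moreover have "p (Suc k + 2) (?i y1) = ?i (p1 (k + 2) y1)"
      using pi[of y1 "k + 2"] T'(1) x'(2) unfolding Y1'_def q_def by auto
    moreover have "?i y1 \<in> Y" "?i z1 \<in> Y" using T'(1,2) unfolding Y_def Y1'_def by blast+
    moreover have "{?i x1, ?i y1} \<in> F" "{?i x1, ?i z1} \<in> F"
      using inF[OF T'(4) that(2)] inF[OF T'(5) that(3)] by simp_all
    ultimately show ?thesis unfolding tight_corner_def using insert_mono[OF T'(6)] by simp
  qed
  moreover have "spare_chain (Suc n) (Suc k) Y F p (\<lambda>j. p0 j y) x z" if T: "tight_corner (Suc k) Y0 F0 p0 z x y" for z
  proof -
    have T': "z \<in> Y0" "z \<noteq> y" "{x, z} \<in> F0" "z \<subseteq> p0 (Suc k + 2) y" using T unfolding tight_corner_def by auto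
    have zx: "z \<noteq> x" using T'(1) Y0 xl level_disjoint[of "Suc k" "Suc (Suc k)" n] by auto
    have yx: "y \<noteq> x" using y Y0 xl level_disjoint[of "Suc k" "Suc (Suc k)" n] by auto
    have "{x, z} \<noteq> {x, y}" "{x, z} \<noteq> {y, x'}" using T'(2) zx yx by (metis doubleton_eq_iff)+
    then have "{x, z} \<in> F0 - {{x, y}, {y, x'}}" using T'(3) by simp
    then have xz: "{x, z} \<in> F" unfolding F_def by (rule insertI2[OF insertI2[OF UnI1[OF insertI2[OF UnI1]]]])
    have xy: "x \<subseteq> p0 (Suc (Suc k)) y"
      using chain_cycle_edge[OF S0 e(1) y] chain_cycleD(5)[OF S0 y] by simp
    have off: "p0 j y \<in> level (Suc n) j \<and> p0 j y \<notin> p j ` Y" if "j \<in> {Suc (Suc k)..Suc n - Suc (Suc k)}" for j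
    proof
      have j: "Suc (Suc k) \<le> j" "j \<le> m" using that m by auto
      then have lev: "p0 j y \<in> level n j" using chain_cycleD(7)[OF S0 _ _ y] m by simp
      then show "p0 j y \<in> level (Suc n) j" using level_mono by blast
      have "p0 j y \<noteq> p j A" if A: "A \<in> C" for A
        using inj_onD[OF chain_cycleD(6)[OF S0 j(1)], of y A] j(2) m y C(1,2)[OF A] pC[OF A j(2)] by auto
      moreover have "p0 j y \<noteq> p j (?i B)" if B: "B \<in> Y1'" for B
        using pi[OF B, of "j - 1"] j(1) Suc_notin_level[OF lev] by auto
      ultimately show "p0 j y \<notin> p j ` Y" unfolding Y_def by blast
    qed
    have mono: "p0 j y \<subseteq> p0 (Suc j) y" if "j \<in> {Suc (Suc k)..<Suc n - Suc (Suc k)}" for j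
      using chain_cycleD(8)[OF S0 _ _ y, of j] that m by auto
    have "x \<in> level (Suc n) (Suc k)" using xl level_mono by blast
    moreover have "z \<in> Y" using T'(1,2) unfolding Y_def C_def by blast
    ultimately show ?thesis unfolding spare_chain_def using xz xy T'(4) off mono by (intro conjI ballI) simp_all
  qed
  ultimately show ?thesis by blast
qed

text \<open>Two distinct sets of codimension one in \<open>C\<close> have union \<open>C\<close>. So
  a flag containing the intersection, one of the sets and \<open>C\<close> determines the other
  set.\<close>

lemma level_pair:
  assumes "A \<in> level n (Suc k)" "B \<in> level n (Suc k)" "A \<noteq> B" "A \<subseteq> C" "B \<subseteq> C" "C \<in> level n (k + 2)"
  shows "A \<inter> B \<in> level n k \<and> B = (A \<inter> B) \<union> (C - A)"
proof -
  have fin: "finite A" "finite B" "finite C"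
    using level_finite[OF assms(1)] level_finite[OF assms(2)] level_finite[OF assms(6)] by simp_all
  have sub: "A \<subseteq> {1..n}" and card: "card A = Suc k" "card B = Suc k" "card C = k + 2"
    using assms(1,2,6) unfolding level_def by simp_all
  have "A \<noteq> A \<union> B"
  proof
    assume "A = A \<union> B"
    then have "B \<subseteq> A" by blast
    then show False using card_subset_eq[OF fin(1), of B] card assms(3) by simp
  qed
  then have "card A < card (A \<union> B)" using fin by (intro psubset_card_mono) auto
  then have "card (A \<union> B) \<ge> card C" using card by simp
  then have C: "A \<union> B = C" using card_seteq[OF fin(3), of "A \<union> B"] assms(4,5) by simp
  have "card (A \<inter> B) = k" using card_Un_Int[OF fin(1,2)] card unfolding C by simp
  moreover have "B = (A \<inter> B) \<union> (C - A)" unfolding C[symmetric] by blast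
  ultimately show ?thesis using sub unfolding level_def by blast
qed

text \<open>Both neighbours of \<open>y\<close> have to be moved to prescribed sets, but a flag
  contains only one of them. The flag is therefore started one level lower with the intersection,
  which fixes the other neighbour by \<open>level_pair\<close>.\<close>

lemma chain_cycle_align:
  assumes n: "2 * k + 3 \<le> n" and S: "chain_cycle n (Suc k) Y F p"
    and y: "y \<in> Y" and e: "{a, y} \<in> F" "{a', y} \<in> F" "a \<noteq> a'"
    and x: "x \<in> level n (Suc k)" "x' \<in> level n (Suc k)" "x \<noteq> x'" "x \<subseteq> r (k + 2)" "x' \<subseteq> r (k + 2)"
    and r: "\<And>j. k + 2 \<le> j \<Longrightarrow> j < n - k \<Longrightarrow> r j \<in> level n j"
      "\<And>j. k + 2 \<le> j \<Longrightarrow> Suc j < n - k \<Longrightarrow> r j \<subseteq> r (Suc j)"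
  shows "\<exists>\<pi>. \<pi> permutes {1..n} \<and> \<pi> ` a = x \<and> \<pi> ` a' = x' \<and>
    (\<forall>j. k + 2 \<le> j \<longrightarrow> j < n - k \<longrightarrow> \<pi> ` p j y = r j)"
proof -
  have a: "a \<in> level n (Suc k)" "a \<subseteq> y" "a' \<in> level n (Suc k)" "a' \<subseteq> y"
    using chain_cycle_edge[OF S _ y] e by auto
  have yl: "y \<in> level n (k + 2)" using chain_cycleD(1)[OF S] y by auto
  have py: "p (k + 2) y = y" using chain_cycleD(5)[OF S y] by simp
  have k2: "k + 2 < n - k" using n by linarith
  note la = level_pair[OF a(1,3) e(3) a(2,4) yl]
    and lx = level_pair[OF x(1-5) r(1)[OF le_refl k2]]
  define s t where "s j = (if j = k then a \<inter> a' else if j = Suc k then a else p j y)"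
    and "t j = (if j = k then x \<inter> x' else if j = Suc k then x else r j)" for j
  have lev: "s j \<in> level n j \<and> t j \<in> level n j" if "j \<in> {k..n - k - 1}" for j
  proof -
    consider "j = k" | "j = Suc k" | "k + 2 \<le> j" "j < n - k" using \<open>j \<in> _\<close> k2 by fastforce
    then show ?thesis
      using a(1) x(1) la lx r(1) chain_cycleD(7)[OF S _ _ y, of j] unfolding s_def t_def by cases auto
  qed
  have sub: "s j \<subseteq> s (Suc j) \<and> t j \<subseteq> t (Suc j)" if "j \<in> {k..<n - k - 1}" for j
  proof -
    consider "j = k" | "j = Suc k" | "k + 2 \<le> j" "Suc j < n - k" using \<open>j \<in> _\<close> k2 by fastforce
    then show ?thesis
    proof cases
      case 2
      then show ?thesis using a(2) x(4) py unfolding s_def t_def by simp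
    next
      case 3
      then show ?thesis using r(2) chain_cycleD(8)[OF S _ _ y, of j] unfolding s_def t_def by auto
    qed (auto simp: s_def t_def)
  qed
  have "k \<le> n - k - 1" using k2 by simp
  from flag_permutes[OF this lev sub]
  obtain \<pi> where \<pi>: "\<pi> permutes {1..n}" "\<And>j. j \<in> {k..n - k - 1} \<Longrightarrow> \<pi> ` s j = t j" by blast
  have inj: "inj \<pi>" using permutes_inj[OF \<pi>(1)] .
  have 1: "\<pi> ` a = x" "\<pi> ` (a \<inter> a') = x \<inter> x'" using \<pi>(2)[of "Suc k"] \<pi>(2)[of k] k2 unfolding s_def t_def by auto
  have 2: "\<pi> ` p j y = r j" if "k + 2 \<le> j" "j < n - k" for j
    using \<pi>(2)[of j] that unfolding s_def t_def by auto
  have "a' = (a \<inter> a') \<union> (y - a)" using la by blast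
  then have "\<pi> ` a' = \<pi> ` (a \<inter> a') \<union> (\<pi> ` y - \<pi> ` a)" using image_set_diff[OF inj] by (metis image_Un)
  also have "\<dots> = (x \<inter> x') \<union> (r (k + 2) - x)" unfolding 1 using 2[of "k + 2"] k2 py by simp
  also have "\<dots> = x'" using lx by blast
  finally show ?thesis using \<pi>(1) 1(1) 2 by blast
qed

text \<open>
  The side conditions reflect where the auxiliary sets exist: a tight corner needs levels k + 1 and k + 2,
  and a spare chain with two sets needs n at least 2 k + 3. The two must not share an edge, because
  gluing removes the edge below the spare chain but has to keep the corner.
\<close>
definition good_system :: "nat \<Rightarrow> nat \<Rightarrow> bool" where
  "good_system n k \<longleftrightarrow> (\<exists>Y F p. chain_cycle n k Y F p \<and>
     (2 * k + 2 \<le> n \<longrightarrow> (\<exists>z x y. tight_corner k Y F p z x y \<and>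
        (2 * k + 3 \<le> n \<longrightarrow>
          (\<exists>r w v. spare_chain n k Y F p r w v \<and> {w, v} \<noteq> {x, y} \<and> {w, v} \<noteq> {x, z})))))"

text \<open>The new corner is that of the second system with n + 1 added; the new spare chain comes
  from the corner of the first. They share no edge, since \<open>x\<close> lacks n + 1 and all sets
  of the new corner contain it.\<close>

lemma good_system_Suc:
  assumes "good_system n (Suc k)" "good_system n k" "2 * k + 3 \<le> n"
  shows "good_system (Suc n) (Suc k)"
proof -
  obtain Y1 F1 p1 where S1: "chain_cycle n k Y1 F1 p1"
    and c: "2 * k + 2 \<le> n \<longrightarrow> (\<exists>z x y. tight_corner k Y1 F1 p1 z x y \<and> (2 * k + 3 \<le> n \<longrightarrow>
          (\<exists>r w v. spare_chain n k Y1 F1 p1 r w v \<and> {w, v} \<noteq> {x, y} \<and> {w, v} \<noteq> {x, z})))"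
    using assms(2) unfolding good_system_def by (elim exE conjE)
  have "2 * k + 2 \<le> n" using assms(3) by simp
  from mp[OF c this] obtain z1 x1 y1 where T1: "tight_corner k Y1 F1 p1 z1 x1 y1"
    and c': "2 * k + 3 \<le> n \<longrightarrow>
          (\<exists>r w v. spare_chain n k Y1 F1 p1 r w v \<and> {w, v} \<noteq> {x1, y1} \<and> {w, v} \<noteq> {x1, z1})"
    by (elim exE conjE)
  from mp[OF c' assms(3)] obtain r w x where R: "spare_chain n k Y1 F1 p1 r w x"
    and ne: "{w, x} \<noteq> {x1, y1}" "{w, x} \<noteq> {x1, z1}"
    by (elim exE conjE)
  obtain Y0 F0 p0 where S0: "chain_cycle n (Suc k) Y0 F0 p0"
    and c0: "2 * Suc k + 2 \<le> n \<longrightarrow> (\<exists>z x y. tight_corner (Suc k) Y0 F0 p0 z x y \<and> (2 * Suc k + 3 \<le> n \<longrightarrow>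
          (\<exists>r w v. spare_chain n (Suc k) Y0 F0 p0 r w v \<and> {w, v} \<noteq> {x, y} \<and> {w, v} \<noteq> {x, z})))"
    using assms(1) unfolding good_system_def by (elim exE conjE)
  have T0: "\<exists>z x y. tight_corner (Suc k) Y0 F0 p0 z x y" if "2 * Suc k + 2 \<le> n"
    using mp[OF c0 that] by blast
  \<comment> \<open>If n = 2 k + 3 then the first system lives on the middle levels and provides no
    corner. Any edge will do, as no spare chain is required for n + 1 = 2 (k + 1) + 2.\<close>
  obtain z a y where zay: "y \<in> Y0" "{a, y} \<in> F0" "2 * Suc k + 2 \<le> n \<Longrightarrow> tight_corner (Suc k) Y0 F0 p0 z a y"
  proof (cases "2 * Suc k + 2 \<le> n")
    case True
    then show ?thesis using T0 that unfolding tight_corner_def by blast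
  next
    case False
    have "F0 \<noteq> {}" using chain_cycleD(3)[OF S0] unfolding ham_cycle_def by blast
    then obtain e where "e \<in> F0" by blast
    then obtain a y where "y \<in> Y0" "{a, y} \<in> F0" using chain_cycleD(4)[OF S0] by metis
    then show ?thesis using that False by blast
  qed
  obtain a' where a': "a' \<noteq> a" "{a', y} \<in> F0"
    using ham_cycle_neighbour[OF chain_cycleD(3)[OF S0] zay(2)] by (metis insert_commute)
  define x' where "x' = r (Suc k)"
  have k2: "k + 2 < n - k" using assms(3) by linarith
  have Rx: "x \<in> Y1" "x \<subseteq> r (k + 2)"
    and Rlev: "\<And>j. Suc k \<le> j \<Longrightarrow> j < n - k \<Longrightarrow> r j \<in> level n j \<and> r j \<notin> p1 j ` Y1"
    and Rmono: "\<And>j. Suc k \<le> j \<Longrightarrow> Suc j < n - k \<Longrightarrow> r j \<subseteq> r (Suc j)"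
    using R unfolding spare_chain_def by auto
  have "x' \<notin> Y1" using Rlev[of "Suc k"] chain_cycleD(5)[OF S1, of x'] k2 unfolding x'_def by force
  then have xx: "x \<noteq> x'" using Rx(1) by blast
  have xl: "x \<in> level n (Suc k)" using Rx(1) chain_cycleD(1)[OF S1] by blast
  have x'l: "x' \<in> level n (Suc k)" "x' \<subseteq> r (k + 2)"
    using Rlev[of "Suc k"] Rmono[of "Suc k"] k2 unfolding x'_def by simp_all
  have r1: "r j \<in> level n j" if "k + 2 \<le> j" "j < n - k" for j using Rlev[of j] that by simp
  have r2: "r j \<subseteq> r (Suc j)" if "k + 2 \<le> j" "Suc j < n - k" for j using Rmono[of j] that by simp
  obtain \<pi> where \<pi>: "\<pi> permutes {1..n}" "\<pi> ` a = x" "\<pi> ` a' = x'"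
    "\<And>j. k + 2 \<le> j \<Longrightarrow> j < n - k \<Longrightarrow> \<pi> ` p0 j y = r j"
    using chain_cycle_align[where r = r, OF assms(3) S0 zay(1,2) a'(2) a'(1)[symmetric] xl x'l(1) xx Rx(2) x'l(2) r1 r2]
    by blast
  let ?Y = "(`) \<pi> ` Y0" and ?F = "(`) ((`) \<pi>) ` F0" and ?p = "\<lambda>j A. \<pi> ` p0 j (inv \<pi> ` A)"
  have S0': "chain_cycle n (Suc k) ?Y ?F ?p" by (rule chain_cycle_permute[OF \<pi>(1) S0])
  have inv: "inv \<pi> ` \<pi> ` A = A" for A using permutes_inj[OF \<pi>(1)] by (simp add: image_inv_f_f)
  have e: "{\<pi> ` c, \<pi> ` b} \<in> ?F" if "{c, b} \<in> F0" for b c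
    using imageI[OF that, of "(`) ((`) \<pi>)"] by simp
  have y': "\<pi> ` y \<in> ?Y" "{x, \<pi> ` y} \<in> ?F" "{r (Suc k), \<pi> ` y} \<in> ?F"
    using zay(1) e[OF zay(2)] e[OF a'(2)] \<pi>(2,3) unfolding x'_def by auto
  have align: "?p j (\<pi> ` y) = r j" if "k + 2 \<le> j" "j < n - k" for j using \<pi>(4)[OF that] by (simp add: inv)
  have "\<exists>Y F p. chain_cycle (Suc n) (Suc k) Y F p \<and>
    (\<forall>z1 x1 y1. tight_corner k Y1 F1 p1 z1 x1 y1 \<and> {w, x} \<noteq> {x1, y1} \<and> {w, x} \<noteq> {x1, z1} \<longrightarrow>
       tight_corner (Suc k) Y F p (insert (Suc n) z1) (insert (Suc n) x1) (insert (Suc n) y1)) \<and>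
    (\<forall>z. tight_corner (Suc k) ?Y ?F ?p z x (\<pi> ` y) \<longrightarrow>
       spare_chain (Suc n) (Suc k) Y F p (\<lambda>j. ?p j (\<pi> ` y)) x z)"
    by (rule chain_cycle_glue[OF assms(3) S0' S1 R y']) (rule align)
  then obtain Y F p where S: "chain_cycle (Suc n) (Suc k) Y F p"
    and T: "\<forall>z1 x1 y1. tight_corner k Y1 F1 p1 z1 x1 y1 \<and> {w, x} \<noteq> {x1, y1} \<and> {w, x} \<noteq> {x1, z1} \<longrightarrow>
       tight_corner (Suc k) Y F p (insert (Suc n) z1) (insert (Suc n) x1) (insert (Suc n) y1)"
    and Q: "\<forall>z. tight_corner (Suc k) ?Y ?F ?p z x (\<pi> ` y) \<longrightarrow>
       spare_chain (Suc n) (Suc k) Y F p (\<lambda>j. ?p j (\<pi> ` y)) x z"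
    by (elim exE conjE)
  have T': "tight_corner (Suc k) Y F p (insert (Suc n) z1) (insert (Suc n) x1) (insert (Suc n) y1)"
    by (rule T[rule_format]) (intro conjI T1 ne)
  have "\<exists>r w v. spare_chain (Suc n) (Suc k) Y F p r w v \<and> {w, v} \<noteq> {insert (Suc n) x1, insert (Suc n) y1} \<and>
      {w, v} \<noteq> {insert (Suc n) x1, insert (Suc n) z1}" if "2 * Suc k + 3 \<le> Suc n"
  proof -
    have "tight_corner (Suc k) Y0 F0 p0 z a y" using zay(3) that by simp
    from tight_corner_permute[OF \<pi>(1) this] have tc: "tight_corner (Suc k) ?Y ?F ?p (\<pi> ` z) x (\<pi> ` y)"
      unfolding \<pi>(2) .
    have "x \<noteq> insert (Suc n) A" for A using Suc_notin_level[OF xl] by blast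
    then have "{x, \<pi> ` z} \<noteq> {insert (Suc n) x1, insert (Suc n) A}" for A by (metis doubleton_eq_iff)
    then show ?thesis using mp[OF spec[OF Q] tc] by (intro exI conjI)
  qed
  then have "2 * Suc k + 3 \<le> Suc n \<longrightarrow> (\<exists>r w v. spare_chain (Suc n) (Suc k) Y F p r w v \<and>
      {w, v} \<noteq> {insert (Suc n) x1, insert (Suc n) y1} \<and> {w, v} \<noteq> {insert (Suc n) x1, insert (Suc n) z1})"
    by (rule impI)
  with T' have "\<exists>z x y. tight_corner (Suc k) Y F p z x y \<and> (2 * Suc k + 3 \<le> Suc n \<longrightarrow>
      (\<exists>r w v. spare_chain (Suc n) (Suc k) Y F p r w v \<and> {w, v} \<noteq> {x, y} \<and> {w, v} \<noteq> {x, z}))"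
    by (intro exI conjI)
  then have "2 * Suc k + 2 \<le> Suc n \<longrightarrow> (\<exists>z x y. tight_corner (Suc k) Y F p z x y \<and>
      (2 * Suc k + 3 \<le> Suc n \<longrightarrow>
      (\<exists>r w v. spare_chain (Suc n) (Suc k) Y F p r w v \<and> {w, v} \<noteq> {x, y} \<and> {w, v} \<noteq> {x, z})))"
    by (rule impI)
  from conjI[OF S this] show ?thesis unfolding good_system_def by (rule_tac x = Y in exI, rule_tac x = F in exI, rule_tac x = p in exI)
qed

section \<open>The base case n = 2 k + 1\<close>

definition support :: "bool list \<Rightarrow> nat set" where
  "support xs = {Suc i | i. i < length xs \<and> xs ! i}"

lemma support_level: "support xs \<in> level (length xs) (count_list xs True)"
proof -
  have "support xs = Suc ` {i. i < length xs \<and> xs ! i}" unfolding support_def by auto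
  then have "card (support xs) = card {i. i < length xs \<and> xs ! i}" by (simp add: card_image)
  also have "\<dots> = count_list xs True"
    by (simp add: count_list_eq_length_filter length_filter_conv_card)
  finally show ?thesis unfolding level_def support_def by auto
qed

lemma support_inj: "length xs = length ys \<Longrightarrow> support xs = support ys \<Longrightarrow> xs = ys"
  by (rule nth_equalityI) (auto simp: support_def set_eq_iff)

lemma support_surj: "A \<in> level n j \<Longrightarrow> \<exists>xs. length xs = n \<and> count_list xs True = j \<and> support xs = A"
proof -
  assume A: "A \<in> level n j"
  define xs where "xs = map (\<lambda>i. Suc i \<in> A) [0..<n]"
  have "A \<subseteq> {1..n}" using A unfolding level_def by blast
  have mem: "support xs = {Suc i | i. i < n \<and> Suc i \<in> A}" unfolding support_def xs_def by auto
  have sup: "support xs = A"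
  proof
    show "A \<subseteq> support xs"
    proof
      fix a assume a: "a \<in> A"
      then have "a \<in> {1..n}" using \<open>A \<subseteq> {1..n}\<close> by blast
      then have "a = Suc (a - 1)" "a - 1 < n" unfolding atLeastAtMost_iff by linarith+
      then show "a \<in> support xs" unfolding mem using a by auto
    qed
  qed (auto simp: mem)
  moreover have "length xs = n" unfolding xs_def by simp
  ultimately have "A \<in> level n (count_list xs True)" using support_level[of xs] by simp
  then have "count_list xs True = j" using A unfolding level_def by simp
  then show ?thesis using sup \<open>length xs = n\<close> by blast
qed

lemma up_support: "up xs ys \<Longrightarrow> support xs \<subseteq> support ys \<and> count_list ys True = Suc (count_list xs True)"
  unfolding up_def support_def by (auto simp: nth_append nth_Cons split: nat.splits)

text \<open>Here \<open>n - k\<close> equals \<open>k + 1\<close>, so every chain is a single set,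
  \<open>Y\<close> is the whole level, and neither a corner nor a spare chain is asked for.\<close>

lemma good_system_middle:
  assumes "k > 0"
  shows "good_system (2 * k + 1) k"
proof -
  let ?n = "2 * k + 1"
  let ?V = "{xs. length xs = ?n \<and> count_list xs True \<in> {k, k + 1}}"
  let ?Y = "level ?n (Suc k)"
  obtain F where F: "F \<subseteq> up_edges" "ham_cycle ?V F" using middle_levels[OF assms] by blast
  have inj: "inj_on support ?V" using support_inj by (intro inj_onI) auto
  have V: "support ` ?V = level ?n k \<union> ?Y"
  proof
    show "support ` ?V \<subseteq> level ?n k \<union> ?Y"
    proof
      fix A assume "A \<in> support ` ?V"
      then obtain xs where "A = support xs" "length xs = ?n" "count_list xs True \<in> {k, k + 1}" by blast
      then show "A \<in> level ?n k \<union> ?Y" using support_level[of xs] by auto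
    qed
    show "level ?n k \<union> ?Y \<subseteq> support ` ?V"
    proof
      fix A assume "A \<in> level ?n k \<union> ?Y"
      then obtain j where "j \<in> {k, k + 1}" "A \<in> level ?n j" by auto
      then obtain xs where "length xs = ?n" "count_list xs True \<in> {k, k + 1}" "support xs = A" using support_surj by blast
      then show "A \<in> support ` ?V" by blast
    qed
  qed
  have "chain_cycle ?n k ?Y ((`) support ` F) (\<lambda>j A. A)"
  proof (rule chain_cycleI)
    show "card ?Y = ?n choose k" using card_level[of ?n "Suc k"] binomial_symmetric[of k ?n] by simp
    show "ham_cycle (level ?n k \<union> ?Y) ((`) support ` F)" using ham_cycle_image[OF F(2) inj] unfolding V .
    show "\<exists>a\<in>level ?n k. \<exists>b\<in>?Y. a \<subseteq> b \<and> e = {a, b}" if e: "e \<in> (`) support ` F" for e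
    proof -
      obtain f where f: "f \<in> F" "e = support ` f" using e by blast
      then obtain xs ys where xy: "f = {xs, ys}" "up xs ys" using F(1) unfolding up_edges_def by blast
      have "xs \<in> ?V" "ys \<in> ?V" using ham_cycle_edge_subset[OF F(2) f(1)] xy(1) by auto
      then have "length xs = ?n" "length ys = ?n" "count_list xs True = k" "count_list ys True = Suc k"
        using up_support[OF xy(2)] by auto
      then have "support xs \<in> level ?n k" "support ys \<in> ?Y" using support_level by metis+
      then show ?thesis using up_support[OF xy(2)] f(2) xy(1) by auto
    qed
    show "A \<in> level ?n j" if "Suc k \<le> j" "j \<le> ?n - k" "A \<in> ?Y" for j A using that by (cases "j = Suc k") auto
  qed auto
  then show ?thesis unfolding good_system_def by fastforce
qed

section \<open>The base case k = 1\<close>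

text \<open>Intervals of length j starting in i, in the cyclic order of \<^term>\<open>{1..n}\<close>.\<close>
definition arc :: "nat \<Rightarrow> nat \<Rightarrow> nat \<Rightarrow> nat set" where
  "arc n i j = {m. i \<le> m \<and> m < i + j \<and> m \<le> n \<or> 1 \<le> m \<and> m + n < i + j}"

lemma arc_level: "i \<in> {1..n} \<Longrightarrow> j \<le> n \<Longrightarrow> arc n i j \<in> level n j"
proof -
  assume i: "i \<in> {1..n}" and j: "j \<le> n"
  have arc: "arc n i j = {i..<min (i + j) (n + 1)} \<union> {1..<i + j - n}"
    using i unfolding arc_def by auto
  have "card (arc n i j) = card {i..<min (i + j) (n + 1)} + card {1..<i + j - n}"
    unfolding arc using i j by (intro card_Un_disjoint) auto
  also have "\<dots> = j" using i j by (cases "i + j \<le> n + 1") auto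
  finally have "card (arc n i j) = j" .
  moreover have "arc n i j \<subseteq> {1..n}" unfolding arc_def using i j by auto
  ultimately show ?thesis unfolding level_def by blast
qed

text \<open>A nonempty arc that is not the whole circle has exactly one element whose predecessor is
  missing, namely its start.\<close>

lemma arc_inj: "1 \<le> j \<Longrightarrow> j < n \<Longrightarrow> inj_on (\<lambda>i. arc n i j) {1..n}"
proof (rule linorder_inj_onI')
  fix a b assume j: "1 \<le> j" "j < n" and ab: "a \<in> {1..n}" "b \<in> {1..n}" "a < b"
  show "arc n a j \<noteq> arc n b j"
  proof
    assume eq: "arc n a j = arc n b j"
    have "b \<in> arc n b j" unfolding arc_def using ab j by auto
    then have "b \<in> arc n a j" unfolding eq .
    then have "b - 1 \<in> arc n a j" unfolding arc_def using ab j by auto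
    then have "b - 1 \<in> arc n b j" unfolding eq .
    then show False unfolding arc_def using ab j by auto
  qed
qed

lemma level_1: "level n 1 = (\<lambda>m. {m}) ` {1..n}"
  unfolding level_def by (auto simp: card_1_singleton_iff)

text \<open>Singletons and pairs of neighbours alternate around the circle, and the chain of a pair
  consists of the arcs with the same start. The corner is {2, 3}, {2}, {1, 2}, since {2, 3} lies in
  the arc {1, 2, 3}.\<close>

lemma good_system_1:
  assumes n: "4 \<le> n"
  shows "good_system n 1"
proof -
  define X where "X l = (if l = n then {1} else {Suc l})" for l
  define Z where "Z l = arc n l 2" for l
  define Y where "Y = Z ` {1..n}"
  define p where "p j A = arc n (inv_into {1..n} Z A) j" for j A
  define F where "F = insert {X n, Z 1} (alt_edges X Z 1 n)"
  have injX: "inj_on X {1..n}" unfolding X_def by (rule inj_onI) (auto split: if_splits)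
  have injZ: "inj_on Z {1..n}" unfolding Z_def using arc_inj[of 2 n] n by simp
  have Zl: "Z l \<in> level n 2" if "l \<in> {1..n}" for l unfolding Z_def using arc_level[OF that] n by simp
  have X: "X ` {1..n} = level n 1"
  proof
    show "X ` {1..n} \<subseteq> level n 1" unfolding X_def level_def using n by auto
    show "level n 1 \<subseteq> X ` {1..n}"
    proof
      fix A assume "A \<in> level n 1"
      then obtain m where m: "A = {m}" "1 \<le> m" "m \<le> n" unfolding level_1 by auto
      show "A \<in> X ` {1..n}"
      proof (cases "m = 1")
        case True
        then show ?thesis using m n unfolding X_def by (intro image_eqI[of _ _ n]) auto
      next
        case False
        then show ?thesis using m unfolding X_def by (intro image_eqI[of _ _ "m - 1"]) auto
      qed
    qed
  qed
  have Ysub: "Y \<subseteq> level n 2" unfolding Y_def using Zl by blast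
  have p: "p j (Z i) = arc n i j" if "i \<in> {1..n}" for i j
    unfolding p_def using inv_into_f_f[OF injZ that] by simp
  have disj: "X ` {1..n} \<inter> Z ` {1..n} = {}" using X Ysub level_disjoint[of 1 2 n] unfolding Y_def by auto
  have P: "ham_path (X ` {1..n} \<union> Z ` {1..n}) (alt_edges X Z 1 n) (Z 1) (X n)"
    using n injX injZ disj by (intro ham_path_alternating) auto
  have "card (X ` {1..n} \<union> Z ` {1..n}) = n + n"
    using disj injX injZ by (simp add: card_Un_disjoint card_image)
  then have cyc: "ham_cycle (level n 1 \<union> Y) F"
    using ham_path_close[OF P] n unfolding F_def X Y_def by simp
  have XZ: "{X l, Z l} \<in> F" if "l \<in> {1..n}" for l
    using that unfolding F_def alt_edges_def by (auto simp: insert_commute[of "X l"])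
  have XZS: "{X l, Z (Suc l)} \<in> F" if "l \<in> {1..<n}" for l
    using that unfolding F_def alt_edges_def by auto
  have sub: "X l \<subseteq> Z l" if "l \<in> {1..n}" for l using that n unfolding X_def Z_def arc_def by auto
  have subS: "X l \<subseteq> Z (Suc l)" if "l \<in> {1..<n}" for l using that n unfolding X_def Z_def arc_def by auto
  have subn: "X n \<subseteq> Z 1" using n unfolding X_def Z_def arc_def by auto
  have S: "chain_cycle n 1 Y F p"
  proof (rule chain_cycleI)
    show "Y \<subseteq> level n (Suc 1)" using Ysub by (simp add: numeral_2_eq_2)
    show "card Y = n choose 1" unfolding Y_def using card_image[OF injZ] by simp
    show "ham_cycle (level n 1 \<union> Y) F" by (rule cyc)
    show "\<exists>a\<in>level n 1. \<exists>b\<in>Y. a \<subseteq> b \<and> e = {a, b}" if e: "e \<in> F" for e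
    proof -
      have in_X: "X l \<in> level n 1" and in_Y: "Z l \<in> Y" if "l \<in> {1..n}" for l
        using that X unfolding Y_def by blast+
      consider "e = {X n, Z 1}" | l where "l \<in> {1..n}" "e = {Z l, X l}" | l where "l \<in> {1..<n}" "e = {X l, Z (Suc l)}"
        using e unfolding F_def alt_edges_def by auto
      then show ?thesis
      proof cases
        case 1
        then show ?thesis using in_X[of n] in_Y[of 1] subn n by auto
      next
        case 2
        then have "e = {X l, Z l}" by (simp add: insert_commute)
        then show ?thesis using in_X[OF 2(1)] in_Y[OF 2(1)] sub[OF 2(1)] by blast
      next
        case 3
        then show ?thesis using in_X[of l] in_Y[of "Suc l"] subS[OF 3(1)] by auto
      qed
    qed
    show "p (Suc 1) y = y" if "y \<in> Y" for y
      using that p unfolding Y_def Z_def by (auto simp: numeral_2_eq_2)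
    show "inj_on (p j) Y" if "Suc 1 \<le> j" "j \<le> n - 1" for j
    proof -
      have "inj_on (\<lambda>i. arc n i j) {1..n}" using that n by (intro arc_inj) auto
      then have "inj_on (p j \<circ> Z) {1..n}" by (rule inj_on_cong[THEN iffD1, rotated]) (simp add: p)
      then show ?thesis unfolding Y_def by (rule inj_on_imageI)
    qed
    show "p j y \<in> level n j" if "Suc 1 \<le> j" "j \<le> n - 1" "y \<in> Y" for j y
      using that p arc_level[of _ n j] unfolding Y_def by auto
    show "p j y \<subseteq> p (Suc j) y" if "y \<in> Y" for j y
      using that p unfolding Y_def by (auto simp: arc_def)
  qed
  have T: "tight_corner 1 Y F p (Z 2) (X 1) (Z 1)"
  proof -
    have "Z 1 \<in> Y" "Z 2 \<in> Y" using n unfolding Y_def by auto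
    moreover have "Z 2 \<noteq> Z 1" using inj_onD[OF injZ, of 2 1] n by auto
    moreover have "{X 1, Z 1} \<in> F" using XZ[of 1] n by simp
    moreover have "{X 1, Z 2} \<in> F" using XZS[of 1] n by (simp add: numeral_2_eq_2)
    moreover have "Z 2 \<subseteq> arc n 1 3" unfolding Z_def arc_def using n by auto
    moreover have "p (1 + 2) (Z 1) = arc n 1 3" using p[of 1 3] n by (simp add: numeral_3_eq_3)
    ultimately show ?thesis unfolding tight_corner_def by metis
  qed
  have R: "\<exists>r w v. spare_chain n 1 Y F p r w v \<and> {w, v} \<noteq> {X 1, Z 1} \<and> {w, v} \<noteq> {X 1, Z 2}" if n5: "5 \<le> n"
  proof -
    \<comment> \<open>The set {1, 3, ..., j + 1} contains 1 but neither 2 nor, as j is at most n -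
      2, the element n; hence it is not an arc. Its first two members lie above {3} and {3, 4}, an
      edge away from the corner.\<close>
    define r where "r j = insert 1 {3..Suc j}" for j :: nat
    have rl: "r j \<in> level n j \<and> r j \<notin> p j ` Y" if j: "j \<in> {2..n - 2}" for j
    proof
      have "r j \<subseteq> {1..n}" unfolding r_def using j n5 by auto
      moreover have "card (r j) = j" unfolding r_def using j by auto
      ultimately show "r j \<in> level n j" unfolding level_def by simp
      show "r j \<notin> p j ` Y"
      proof
        assume "r j \<in> p j ` Y"
        then obtain i where i: "i \<in> {1..n}" "r j = arc n i j" unfolding Y_def using p by auto
        have "1 \<in> arc n i j" "2 \<notin> arc n i j" "n \<notin> arc n i j"
          unfolding i(2)[symmetric] r_def using j n5 by auto
        then show False using i(1) j n5 unfolding arc_def by auto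
      qed
    qed
    have "spare_chain n 1 Y F p r (X 2) (Z 3)" unfolding spare_chain_def
    proof (intro conjI ballI)
      have "X 2 \<in> X ` {1..n}" using n5 by (intro imageI) simp
      then show "X 2 \<in> level n 1" unfolding X .
      show "Z 3 \<in> Y" unfolding Y_def using n5 by auto
      show "{X 2, Z 3} \<in> F" using XZS[of 2] n5 by (simp add: numeral_2_eq_2 numeral_3_eq_3)
      show "X 2 \<subseteq> r (Suc 1)" unfolding X_def r_def using n5 by auto
      show "Z 3 \<subseteq> r (1 + 2)" unfolding Z_def r_def arc_def using n5 by auto
      show "r j \<in> level n j" "r j \<notin> p j ` Y" if "j \<in> {Suc 1..n - Suc 1}" for j
        using rl[of j] that by (simp_all add: numeral_2_eq_2)
      show "r j \<subseteq> r (Suc j)" for j unfolding r_def by auto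
    qed
    moreover have "X 2 \<noteq> X 1" "X 2 \<noteq> Z 1" "X 2 \<noteq> Z 2"
    proof -
      show "X 2 \<noteq> X 1" unfolding X_def using n5 by auto
      have "2 \<in> Z 1" "2 \<in> Z 2" "2 \<notin> X 2" unfolding X_def Z_def arc_def using n5 by auto
      then show "X 2 \<noteq> Z 1" "X 2 \<noteq> Z 2" by blast+
    qed
    ultimately show ?thesis by (metis doubleton_eq_iff)
  qed
  have "2 * 1 + 3 \<le> n \<longrightarrow> (\<exists>r w v. spare_chain n 1 Y F p r w v \<and> {w, v} \<noteq> {X 1, Z 1} \<and> {w, v} \<noteq> {X 1, Z 2})"
    using R by simp
  with T have "\<exists>z x y. tight_corner 1 Y F p z x y \<and> (2 * 1 + 3 \<le> n \<longrightarrow>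
      (\<exists>r w v. spare_chain n 1 Y F p r w v \<and> {w, v} \<noteq> {x, y} \<and> {w, v} \<noteq> {x, z}))"
    by (intro exI conjI)
  then have "2 * 1 + 2 \<le> n \<longrightarrow> (\<exists>z x y. tight_corner 1 Y F p z x y \<and> (2 * 1 + 3 \<le> n \<longrightarrow>
      (\<exists>r w v. spare_chain n 1 Y F p r w v \<and> {w, v} \<noteq> {x, y} \<and> {w, v} \<noteq> {x, z})))"
    by (rule impI)
  from conjI[OF S this] show ?thesis unfolding good_system_def
    by (rule_tac x = Y in exI, rule_tac x = F in exI, rule_tac x = p in exI)
qed

text \<open>A recursion of Pascal type in (n, k), with boundary n = 2 k + 1 and k = 1.\<close>

lemma good_system_exists: "1 \<le> k \<Longrightarrow> 2 * k + 1 \<le> n \<Longrightarrow> good_system n k"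
proof (induction n arbitrary: k)
  case (Suc n)
  obtain k' where k': "k = Suc k'" using Suc.prems(1) by (cases k) auto
  consider "Suc n = 2 * k + 1" | "k = 1" "4 \<le> Suc n" | "1 \<le> k'" "2 * k + 1 \<le> n"
    using Suc.prems k' by linarith
  then show ?case
  proof cases
    case 1
    then show ?thesis using good_system_middle[of k] Suc.prems(1) by simp
  next
    case 2
    then show ?thesis using good_system_1 by simp
  next
    case 3
    have "good_system n (Suc k')" using Suc.IH[of k] 3 k' by simp
    moreover have "good_system n k'" using Suc.IH[of k'] 3 k' by simp
    ultimately show ?thesis using good_system_Suc[of n k'] 3 k' by simp
  qed
qed simp

section \<open>From chains to Hamilton cycles of the bipartite Kneser graph\<close>

text \<open>Containment is transitive, so passing to the tops of the chains keeps edges. There are n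
  choose k distinct tops, so they exhaust level \<open>n - k\<close>.\<close>

lemma chain_cycle_extend:
  assumes S: "chain_cycle n k Y F p" and n: "2 * k + 1 \<le> n"
  shows "\<exists>F'. ham_cycle (level n k \<union> level n (n - k)) F' \<and>
    (\<forall>e\<in>F'. \<exists>a\<in>level n k. \<exists>b\<in>level n (n - k). a \<subseteq> b \<and> e = {a, b})"
proof -
  let ?p = "p (n - k)"
  define f where "f A = (if A \<in> level n k then A else ?p A)" for A
  have Sk: "Suc k \<le> n - k" using n by simp
  have nY: "A \<notin> level n k" if "A \<in> Y" for A
    using that chain_cycleD(1)[OF S] level_disjoint[of k "Suc k" n] by auto
  have fY: "f A = ?p A" if "A \<in> Y" for A using nY[OF that] unfolding f_def by simp
  have fY_in: "?p A \<in> level n (n - k)" if "A \<in> Y" for A using chain_cycleD(7)[OF S Sk _ that] by simp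
  have injp: "inj_on ?p Y" using chain_cycleD(6)[OF S Sk] by simp
  have imp: "?p ` Y = level n (n - k)"
  proof (rule card_subset_eq[OF finite_level])
    show "?p ` Y \<subseteq> level n (n - k)" using fY_in by blast
    show "card (?p ` Y) = card (level n (n - k))"
      using card_image[OF injp] chain_cycleD(2)[OF S] card_level[of n "n - k"] binomial_symmetric[of k n] n by simp
  qed
  have "f ` Y = ?p ` Y" using fY by (rule image_cong[OF refl])
  moreover have "f ` level n k = level n k" unfolding f_def by simp
  ultimately have im: "f ` (level n k \<union> Y) = level n k \<union> level n (n - k)"
    unfolding image_Un imp by simp
  have "inj_on f (level n k \<union> Y)"
  proof (rule inj_onI)
    fix A B assume AB: "A \<in> level n k \<union> Y" "B \<in> level n k \<union> Y" "f A = f B"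
    have "level n k \<inter> level n (n - k) = {}" using Sk by (intro level_disjoint) simp
    then have out: "?p C \<notin> level n k" if "C \<in> Y" for C using fY_in[OF that] by blast
    show "A = B"
      using AB out inj_onD[OF injp, of A B] unfolding f_def by (auto split: if_splits)
  qed
  from ham_cycle_image[OF chain_cycleD(3)[OF S] this]
  have "ham_cycle (level n k \<union> level n (n - k)) ((`) f ` F)" unfolding im .
  moreover have "\<exists>a\<in>level n k. \<exists>b\<in>level n (n - k). a \<subseteq> b \<and> e = {a, b}" if e: "e \<in> (`) f ` F" for e
  proof -
    obtain g where g: "g \<in> F" "e = f ` g" using e by blast
    obtain a b where ab: "a \<in> level n k" "b \<in> Y" "a \<subseteq> b" "g = {a, b}" using chain_cycleD(4)[OF S g(1)] by blast
    have "b \<subseteq> p j b" if "Suc k \<le> j" "j \<le> n - k" for j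
      using that
    proof (induction j rule: dec_induct)
      case base
      then show ?case using chain_cycleD(5)[OF S ab(2)] by simp
    next
      case (step j)
      then show ?case using chain_cycleD(8)[OF S _ _ ab(2), of j] by fastforce
    qed
    then have "a \<subseteq> ?p b" using ab(3) Sk by blast
    moreover have "f a = a" unfolding f_def using ab(1) by simp
    then have "e = {a, ?p b}" using g(2) ab(4) fY[OF ab(2)] by simp
    ultimately show ?thesis using ab(1) fY_in[OF ab(2)] by blast
  qed
  ultimately show ?thesis by blast
qed

lemma vwalk_arcs_walk:
  "ys \<noteq> [] \<Longrightarrow> pcas (hd ys) (vwalk_arcs ys) (last ys) \<and> pawalk_verts (hd ys) (vwalk_arcs ys) = ys
     \<and> fst ` set (vwalk_arcs ys) = set (butlast ys)"
  by (induction ys rule: vwalk_arcs.induct) auto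

lemma vwalk_arcs_path_edges: "(u, v) \<in> set (vwalk_arcs ys) \<Longrightarrow> {u, v} \<in> path_edges ys"
  by (induction ys rule: vwalk_arcs.induct) auto

lemma ham_cycle_imp_hamiltonian_cycle:
  assumes "ham_cycle (pverts G) F" and arc: "\<And>u v. {u, v} \<in> F \<Longrightarrow> (u, v) \<in> parcs G"
  shows "\<exists>p. pre_digraph.hamiltonian_cycle (with_proj G) p"
proof -
  obtain xs where xs: "distinct xs" "3 \<le> length xs" "set xs = pverts G"
    "insert {last xs, hd xs} (path_edges xs) = F"
    using assms(1) unfolding ham_cycle_def by blast
  then have ne: "xs \<noteq> []" by auto
  \<comment> \<open>Repeating the head turns the cyclic list into a closed walk whose arcs include
    the closing edge.\<close>
  define ys where "ys = xs @ [hd xs]"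
  define p where "p = vwalk_arcs ys"
  have ys: "ys \<noteq> []" "hd ys = hd xs" "last ys = hd xs" "butlast ys = xs" using ne unfolding ys_def by simp_all
  have "path_edges ys = F" using path_edges_append[OF ne, of "[hd xs]"] xs(4) unfolding ys_def by simp
  then have arcs: "set p \<subseteq> parcs G" using arc vwalk_arcs_path_edges unfolding p_def by (metis subrelI)
  have w: "pcas (hd xs) p (hd xs)" "pawalk_verts (hd xs) p = ys" "fst ` set p = set xs"
    using vwalk_arcs_walk[OF ys(1)] ys unfolding p_def by simp_all
  have "length p = length xs" unfolding p_def ys_def
    using vwalk_length_simp[of "xs @ [hd xs]"] unfolding vwalk_length_def by simp
  then have len: "3 \<le> length p" "p \<noteq> []" using xs(2) by auto
  have "distinct (tl ys)" using xs(1) ne unfolding ys_def by (cases xs) auto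
  moreover have "hd xs \<in> pverts G" using hd_in_set[OF ne] unfolding xs(3) .
  ultimately have "pre_digraph.cycle (with_proj G) p"
    unfolding pre_digraph.cycle_def pre_digraph.awalk_def
    using arcs w len by (intro exI[of _ "hd xs"]) (simp add: cas_with_proj_eq awalk_verts_with_proj_eq)
  then show ?thesis unfolding pre_digraph.hamiltonian_cycle_def
    using len w(3) xs(3) by (intro exI[of _ p]) simp
qed

theorem theorem10:
  fixes n k :: nat
  assumes "k \<ge> 1" and "n \<ge> 2 * k + 1"
  shows "\<exists>p. pre_digraph.hamiltonian_cycle (with_proj (bipartite_kneser n k)) p"
proof -
  obtain Y F p where "chain_cycle n k Y F p"
    using good_system_exists[OF assms] unfolding good_system_def by (elim exE conjE)
  then obtain F where F: "ham_cycle (level n k \<union> level n (n - k)) F"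
    "\<And>e. e \<in> F \<Longrightarrow> \<exists>a\<in>level n k. \<exists>b\<in>level n (n - k). a \<subseteq> b \<and> e = {a, b}"
    using chain_cycle_extend assms(2) by meson
  have V: "pverts (bipartite_kneser n k) = level n k \<union> level n (n - k)"
    unfolding bipartite_kneser_def bipartite_kneser_verts_def level_def by simp
  show ?thesis
  proof (rule ham_cycle_imp_hamiltonian_cycle)
    show "ham_cycle (pverts (bipartite_kneser n k)) F" using F(1) unfolding V .
    fix u v assume uv: "{u, v} \<in> F"
    obtain a b where ab: "a \<in> level n k" "b \<in> level n (n - k)" "a \<subseteq> b" "{u, v} = {a, b}"
      using F(2)[OF uv] by (elim bexE conjE)
    have "a \<noteq> b" using ab(1,2) assms(2) unfolding level_def by auto
    moreover have "u = a \<and> v = b \<or> u = b \<and> v = a" using ab(4) by (simp add: doubleton_eq_iff)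
    moreover have "a \<in> bipartite_kneser_verts n k" "b \<in> bipartite_kneser_verts n k"
      using ab(1,2) unfolding bipartite_kneser_verts_def level_def by auto
    ultimately show "(u, v) \<in> parcs (bipartite_kneser n k)"
      using ab(3) unfolding bipartite_kneser_def by auto
  qed
qed

end
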